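(* Let $G$ be a graph and $\theta$ a real number, and let $Q_1,\dots,Q_m$ be the components of $G\setminus A_\theta(G)$ with $\mathrm{mult}(\theta,Q_j)=0$. For distinct vertices $u,v$, $\mathrm{mult}(\theta,S_\theta(G)\setminus\{u,v\})=\mathrm{mult}(\theta,S_\theta(G))+2$ if and only if one of the following holds: (a) $u,v\in A_\theta(G)$; (b) one of $u,v$ lies in $A_\theta(G)$ and the other in $P_\theta(G)$; (c) $u,v\in P_\theta(G)$ with $u\in V(Q_{j_1})$, $v\in V(Q_{j_2})$ for some $j_1\neq j_2$; (d) $u,v\in V(Q_{j_0})$ for some $j_0$ and $\mathrm{mult}(\theta,Q_{j_0}\setminus\{u,v\})=2$.
   Context: All graphs are finite and simple. For a graph $G$ on $n$ vertices, let $p(G,r)$ be the number of $r$-matchings of $G$ ($p(G,0)=1$); the matching polynomial is $\mu(G,x)=\sum_{r=0}^{\lfloor n/2\rfloor}(-1)^r p(G,r)x^{n-2r}$. For real $\theta$, $\mathrm{mult}(\theta,G)$ is the multiplicity of $\theta$ as a root of $\mu(G,x)$ (it is $0$ if $\theta$ is not a root). $G\setminus X$ denotes deletion of the vertex set $X$; $G\setminus u=G\setminus\{u\}$. A vertex $u$ is $\theta$-essential, $\theta$-neutral, or $\theta$-positive in $G$ according as $\mathrm{mult}(\theta,G\setminus u)$ equals $\mathrm{mult}(\theta,G)-1$, $\mathrm{mult}(\theta,G)$, or $\mathrm{mult}(\theta,G)+1$. A vertex is $\theta$-special if it is not $\theta$-essential but is adjacent to a $\theta$-essential vertex. $A_\theta(G)$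 is the set of $\theta$-special vertices and $P_\theta(G)$ the set of $\theta$-positive vertices that are not $\theta$-special. A connected graph is $\theta$-critical if all its vertices are $\theta$-essential in it; every component of $G\setminus A_\theta(G)$ is either $\theta$-critical or has $\mathrm{mult}(\theta,\cdot)=0$. $S_\theta(G)$ is the graph on $V(G)$ whose edges are the edges of $G$ together with all pairs $\{w,z\}$, $z\neq w$, with $w\in A_\theta(G)$. *)

theory Defs
  imports "HOL-Computational_Algebra.Polynomial"
begin

type_synonym 'a graph = "'a set \<times> 'a set set"

definition verts :: "'a graph \<Rightarrow> 'a set" where "verts G = fst G"
definition edges :: "'a graph \<Rightarrow> 'a set set" where "edges G = snd G"

definition simple_graph :: "'a graph \<Rightarrow> bool" where
  "simple_graph G \<longleftrightarrow> finite (verts G) \<and>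
     (\<forall>e\<in>edges G. \<exists>x y. e = {x, y} \<and> x \<noteq> y \<and> x \<in> verts G \<and> y \<in> verts G)"

definition adj :: "'a graph \<Rightarrow> 'a \<Rightarrow> 'a \<Rightarrow> bool" where
  "adj G x y \<longleftrightarrow> {x, y} \<in> edges G"

definition delete :: "'a graph \<Rightarrow> 'a set \<Rightarrow> 'a graph" where
  "delete G X = (verts G - X, {e \<in> edges G. e \<inter> X = {}})"

definition induced :: "'a graph \<Rightarrow> 'a set \<Rightarrow> 'a graph" where
  "induced G C = (C \<inter> verts G, {e \<in> edges G. e \<subseteq> C})"

definition is_matching :: "'a graph \<Rightarrow> 'a set set \<Rightarrow> bool" where
  "is_matching G M \<longleftrightarrow> M \<subseteq> edges G \<and> (\<forall>e\<in>M. \<forall>f\<in>M. e \<noteq> f \<longrightarrow> e \<inter> f = {})"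

definition num_matchings :: "'a graph \<Rightarrow> nat \<Rightarrow> nat" where
  "num_matchings G r = card {M. is_matching G M \<and> card M = r}"

definition matching_poly :: "'a graph \<Rightarrow> real poly" where
  "matching_poly G = (\<Sum>r\<in>{0..card (verts G) div 2}.
      monom ((-1) ^ r * real (num_matchings G r)) (card (verts G) - 2 * r))"

definition mult :: "real \<Rightarrow> 'a graph \<Rightarrow> nat" where
  "mult \<theta> G = order \<theta> (matching_poly G)"

definition essential :: "real \<Rightarrow> 'a graph \<Rightarrow> 'a \<Rightarrow> bool" where
  "essential \<theta> G u \<longleftrightarrow> u \<in> verts G \<and> int (mult \<theta> (delete G {u})) = int (mult \<theta> G) - 1"

definition neutral :: "real \<Rightarrow> 'a graph \<Rightarrow> 'a \<Rightarrow> bool" where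
  "neutral \<theta> G u \<longleftrightarrow> u \<in> verts G \<and> mult \<theta> (delete G {u}) = mult \<theta> G"

definition positive :: "real \<Rightarrow> 'a graph \<Rightarrow> 'a \<Rightarrow> bool" where
  "positive \<theta> G u \<longleftrightarrow> u \<in> verts G \<and> mult \<theta> (delete G {u}) = mult \<theta> G + 1"

definition special :: "real \<Rightarrow> 'a graph \<Rightarrow> 'a \<Rightarrow> bool" where
  "special \<theta> G u \<longleftrightarrow> u \<in> verts G \<and> \<not> essential \<theta> G u \<and>
     (\<exists>w. adj G u w \<and> essential \<theta> G w)"

definition A_set :: "real \<Rightarrow> 'a graph \<Rightarrow> 'a set" where
  "A_set \<theta> G = {u \<in> verts G. special \<theta> G u}"

definition P_set :: "real \<Rightarrow> 'a graph \<Rightarrow> 'a set" where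
  "P_set \<theta> G = {u \<in> verts G. positive \<theta> G u \<and> \<not> special \<theta> G u}"

definition reachable :: "'a graph \<Rightarrow> 'a \<Rightarrow> 'a \<Rightarrow> bool" where
  "reachable G x y \<longleftrightarrow> x \<in> verts G \<and> (x, y) \<in> {(a, b). adj G a b}\<^sup>*"

definition components :: "'a graph \<Rightarrow> 'a set set" where
  "components G = {{y. reachable G x y} | x. x \<in> verts G}"

definition S_graph :: "real \<Rightarrow> 'a graph \<Rightarrow> 'a graph" where
  "S_graph \<theta> G = (verts G, edges G \<union>
     {{w, z} | w z. w \<in> A_set \<theta> G \<and> z \<in> verts G \<and> z \<noteq> w})"

end

theory Submission
  imports Defs
begin

text \<open>
  Write \<open>\<nu>\<close> for the multiplicity of \<open>\<theta>\<close>. For the matching polynomial with arbitrary real vertex weights,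
  \<open>\<mu>(G-u) \<mu>(G-v) - \<mu>(G) \<mu>(G-u-v)\<close> is nonnegative, and at least \<open>\<mu>(G-u-v)\<^sup>2\<close> if \<open>u\<close> and \<open>v\<close>
  are adjacent. Comparing orders of vanishing at \<open>\<theta>\<close> yields interlacing, the criterion that \<open>w\<close> is
  positive iff some neighbour of \<open>w\<close> is essential in \<open>G-w\<close>, and, perturbing one weight linearly, that
  \<open>\<nu>(G-a-b) \<ge> \<nu>(G) - 1\<close> is a transitive relation on essential vertices. Transitivity implies
  stability: deleting a special vertex changes neither the type of any other vertex nor the set of
  other special vertices. Since the criterion only looks at \<open>G-w\<close>, adding edges at a special vertex
  \<open>w\<close> changes no types either, so \<open>G\<close> and \<open>S\<^sub>\<theta>(G)\<close> have the same multiplicity and types. A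
  special vertex stays special when a positive vertex is deleted, which reduces the case
  \<open>u, v \<notin> A\<^sub>\<theta>(G)\<close> to \<open>G - A\<^sub>\<theta>(G)\<close>. That graph has no special vertex, so its components either
  consist of essential vertices or have multiplicity 0, and \<open>\<nu>\<close> is additive over components.
\<close>

section \<open>Weighted matching polynomials\<close>

text \<open>
  The edge set is kept fixed and only the vertex set varies: \<open>matchings E V\<close> are the matchings of the
  subgraph induced on \<open>V\<close>, where \<open>E\<close> may contain edges leaving \<open>V\<close>.
\<close>

definition loopless :: "'a set set \<Rightarrow> bool" where
  "loopless E \<longleftrightarrow> (\<forall>e\<in>E. \<exists>x y. e = {x, y} \<and> x \<noteq> y)"

definition matchings :: "'a set set \<Rightarrow> 'a set \<Rightarrow> 'a set set set" where
  "matchings E V = {M. M \<subseteq> E \<and> (\<forall>e\<in>M. \<forall>f\<in>M. e \<noteq> f \<longrightarrow> e \<inter> f = {}) \<and> \<Union>M \<subseteq> V}"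

text \<open>Weight \<open>[:0, 1:]\<close> at every vertex gives the matching polynomial, real
  weights give its values; a separate weight for each vertex serves the perturbation in
  \<open>parallel_trans\<close>.\<close>

definition matching_sum :: "'a set set \<Rightarrow> 'a set \<Rightarrow> ('a \<Rightarrow> 'b) \<Rightarrow> 'b::comm_ring_1" where
  "matching_sum E V x = (\<Sum>M\<in>matchings E V. (-1) ^ card M * (\<Prod>v\<in>V - \<Union>M. x v))"

abbreviation nbrs :: "'a set set \<Rightarrow> 'a set \<Rightarrow> 'a \<Rightarrow> 'a set" where
  "nbrs E V u \<equiv> {w \<in> V. {u, w} \<in> E}"

lemma loopless_neq: "loopless E \<Longrightarrow> {u, w} \<in> E \<Longrightarrow> u \<noteq> w"
  by (auto simp: loopless_def doubleton_eq_iff)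

lemma loopless_edge_through: "loopless E \<Longrightarrow> e \<in> E \<Longrightarrow> u \<in> e \<Longrightarrow> \<exists>w. e = {u, w} \<and> w \<noteq> u"
  unfolding loopless_def by (fastforce simp: doubleton_eq_iff)

lemma finite_matchings: "finite V \<Longrightarrow> finite (matchings E V)"
  by (rule finite_subset[of _ "Pow (Pow V)"]) (auto simp: matchings_def)

lemma finite_matching: "finite V \<Longrightarrow> M \<in> matchings E V \<Longrightarrow> finite M"
  by (rule finite_subset[of _ "Pow V"]) (auto simp: matchings_def)

lemma matchings_empty: "loopless E \<Longrightarrow> matchings E {} = {{}}"
  unfolding matchings_def loopless_def by fastforce

lemma matching_sum_empty [simp]: "loopless E \<Longrightarrow> matching_sum E {} x = 1"
  by (simp add: matching_sum_def matchings_empty)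

lemma matchings_decompose:
  assumes E: "loopless E" and u: "u \<in> V"
  shows "matchings E V = matchings E (V - {u}) \<union>
    (\<Union>w\<in>nbrs E V u. insert {u, w} ` matchings E (V - {u, w}))" (is "_ = ?R")
proof
  show "?R \<subseteq> matchings E V"
    using u by (auto simp: matchings_def)
  show "matchings E V \<subseteq> ?R"
  proof
    fix M assume M: "M \<in> matchings E V"
    show "M \<in> ?R"
    proof (cases "u \<in> \<Union>M")
      case False
      then show ?thesis using M by (auto simp: matchings_def)
    next
      case True
      then obtain e where e: "e \<in> M" "u \<in> e" by blast
      have "e \<in> E" using M e(1) by (auto simp: matchings_def)
      from loopless_edge_through[OF E this e(2)]
      obtain w where w: "e = {u, w}" "w \<noteq> u" by (elim exE conjE)
      have "M - {e} \<in> matchings E (V - {u, w})"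
      proof -
        have dj: "f \<inter> {u, w} = {}" if "f \<in> M - {e}" for f
          using M e(1) that unfolding w(1) matchings_def by simp
        have "f \<subseteq> V - {u, w}" if "f \<in> M - {e}" for f
          using dj[OF that] M that by (auto simp: matchings_def)
        then show ?thesis using M by (auto simp: matchings_def)
      qed
      moreover have "M = insert {u, w} (M - {e})" using e w by auto
      moreover have "w \<in> nbrs E V u" using M e w by (auto simp: matchings_def)
      ultimately show ?thesis by blast
    qed
  qed
qed

lemma matching_sum_rec:
  assumes E: "loopless E" and fin: "finite V" and u: "u \<in> V"
  shows "matching_sum E V x =
    x u * matching_sum E (V - {u}) x - (\<Sum>w\<in>nbrs E V u. matching_sum E (V - {u, w}) x)"
proof -
  define t where "t M = (-1) ^ card M * (\<Prod>v\<in>V - \<Union>M. x v)" for M :: "'a set set"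
  let ?I = "\<lambda>w. insert {u, w} ` matchings E (V - {u, w})"
  have notin: "{u, w} \<notin> M" if "M \<in> matchings E (V - {u, w'})" for M w w'
    using that by (auto simp: matchings_def)
  have "(\<Sum>M\<in>matchings E V. t M) =
      (\<Sum>M\<in>matchings E (V - {u}). t M) + (\<Sum>M\<in>(\<Union>w\<in>nbrs E V u. ?I w). t M)"
    unfolding matchings_decompose[OF E u]
  proof (rule sum.union_disjoint)
    show "finite (matchings E (V - {u}))" using fin by (simp add: finite_matchings)
    show "finite (\<Union>w\<in>nbrs E V u. ?I w)" using fin by (simp add: finite_matchings)
    have "u \<notin> \<Union>M" if "M \<in> matchings E (V - {u})" for M
      using that by (auto simp: matchings_def)
    then show "matchings E (V - {u}) \<inter> (\<Union>w\<in>nbrs E V u. ?I w) = {}" by fastforce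
  qed
  also have "(\<Sum>M\<in>matchings E (V - {u}). t M) = x u * matching_sum E (V - {u}) x"
    unfolding matching_sum_def sum_distrib_left
  proof (rule sum.cong[OF refl])
    fix M assume "M \<in> matchings E (V - {u})"
    then have "V - \<Union>M = insert u (V - {u} - \<Union>M)" using u by (auto simp: matchings_def)
    then have "(\<Prod>v\<in>V - \<Union>M. x v) = x u * (\<Prod>v\<in>V - {u} - \<Union>M. x v)" using fin by simp
    then show "t M = x u * ((-1) ^ card M * (\<Prod>v\<in>V - {u} - \<Union>M. x v))"
      by (simp add: t_def mult.left_commute)
  qed
  also have "(\<Sum>M\<in>(\<Union>w\<in>nbrs E V u. ?I w). t M) = (\<Sum>w\<in>nbrs E V u. \<Sum>M\<in>?I w. t M)"
  proof (rule sum.UNION_disjoint)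
    show "\<forall>w\<in>nbrs E V u. \<forall>w'\<in>nbrs E V u. w \<noteq> w' \<longrightarrow> ?I w \<inter> ?I w' = {}"
    proof (intro ballI impI equals0I)
      fix w w' M assume "w \<noteq> w'" "M \<in> ?I w \<inter> ?I w'"
      then obtain M' where "M' \<in> matchings E (V - {u, w'})" "{u, w} \<in> insert {u, w'} M'"
        by blast
      then show False using notin[of M' w' w] \<open>w \<noteq> w'\<close> by (auto simp: doubleton_eq_iff)
    qed
  qed (use fin in \<open>simp_all add: finite_matchings\<close>)
  also have "\<dots> = (\<Sum>w\<in>nbrs E V u. - matching_sum E (V - {u, w}) x)"
  proof (rule sum.cong[OF refl])
    fix w assume w: "w \<in> nbrs E V u"
    have "(\<Sum>M\<in>?I w. t M) = (\<Sum>M\<in>matchings E (V - {u, w}). t (insert {u, w} M))"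
    proof (subst sum.reindex)
      show "inj_on (insert {u, w}) (matchings E (V - {u, w}))"
      proof (rule inj_onI)
        fix M M' assume "M \<in> matchings E (V - {u, w})" "M' \<in> matchings E (V - {u, w})"
          and eq: "insert {u, w} M = insert {u, w} M'"
        then have "{u, w} \<notin> M" "{u, w} \<notin> M'" by (auto dest: notin)
        with eq show "M = M'" by (simp add: insert_ident)
      qed
    qed simp
    also have "\<dots> = (\<Sum>M\<in>matchings E (V - {u, w}).
        - ((-1) ^ card M * (\<Prod>v\<in>V - {u, w} - \<Union>M. x v)))"
    proof (rule sum.cong[OF refl])
      fix M assume M: "M \<in> matchings E (V - {u, w})"
      have "card (insert {u, w} M) = Suc (card M)"
        using finite_matching[OF _ M] notin[OF M] fin by simp
      moreover have "V - \<Union>(insert {u, w} M) = V - {u, w} - \<Union>M" by auto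
      ultimately show "t (insert {u, w} M) = - ((-1) ^ card M * (\<Prod>v\<in>V - {u, w} - \<Union>M. x v))"
        by (simp only: t_def) simp
    qed
    finally show "(\<Sum>M\<in>?I w. t M) = - matching_sum E (V - {u, w}) x"
      by (simp add: matching_sum_def sum_negf)
  qed
  finally show ?thesis by (simp add: matching_sum_def t_def sum_negf)
qed

lemma matching_sum_cong:
  assumes "\<And>e. e \<subseteq> V \<Longrightarrow> e \<in> E \<longleftrightarrow> e \<in> F" "\<And>v. v \<in> V \<Longrightarrow> x v = y v"
  shows "matching_sum E V x = matching_sum F V y"
proof -
  have "M \<subseteq> E \<longleftrightarrow> M \<subseteq> F" if "\<Union>M \<subseteq> V" for M
    using that assms(1) by (meson Sup_le_iff subset_iff)
  then have "matchings E V = matchings F V"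
    unfolding matchings_def by (intro Collect_cong) metis
  moreover have "(\<Prod>v\<in>V - \<Union>M. x v) = (\<Prod>v\<in>V - \<Union>M. y v)" for M
    by (rule prod.cong) (simp_all add: assms(2))
  ultimately show ?thesis by (simp add: matching_sum_def)
qed

text \<open>The weight of \<open>c\<close> occurs only in the first term of the recurrence at
  \<open>c\<close>, so the sum is affine in it.\<close>

lemma matching_sum_shift:
  assumes "loopless E" "finite V" "c \<in> V"
  shows "matching_sum E V (x(c := x c + s)) = matching_sum E V x + s * matching_sum E (V - {c}) x"
proof -
  have ring: "(a + s) * m - S = (a * m - S) + s * m" for a m S
    by (simp add: algebra_simps)
  have *: "matching_sum E (V - W) (x(c := x c + s)) = matching_sum E (V - W) x" if "c \<in> W" for W
    by (rule matching_sum_cong) (use that in auto)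
  have "matching_sum E V (x(c := x c + s)) = (x c + s) * matching_sum E (V - {c}) x
      - (\<Sum>w\<in>nbrs E V c. matching_sum E (V - {c, w}) x)"
    unfolding matching_sum_rec[OF assms, of "x(c := x c + s)"] by (simp only: * insertI1 fun_upd_same)
  also have "\<dots> = (x c * matching_sum E (V - {c}) x - (\<Sum>w\<in>nbrs E V c. matching_sum E (V - {c, w}) x))
      + s * matching_sum E (V - {c}) x"
    by (rule ring)
  finally show ?thesis
    by (simp only: matching_sum_rec[OF assms, of x])
qed

lemma matching_sum_union:
  assumes E: "loopless E" and "finite V" "finite W" "V \<inter> W = {}"
    and "\<And>v w. v \<in> V \<Longrightarrow> w \<in> W \<Longrightarrow> {v, w} \<notin> E"
  shows "matching_sum E (V \<union> W) x = matching_sum E V x * matching_sum E W x"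
  using assms(2-)
proof (induction "card V" arbitrary: V rule: less_induct)
  case less
  show ?case
  proof (cases "V = {}")
    case False
    then obtain u where u: "u \<in> V" by blast
    have IH: "matching_sum E (V \<union> W - U) x = matching_sum E (V - U) x * matching_sum E W x"
      if "u \<in> U" "U \<subseteq> V" for U
    proof -
      have "V \<union> W - U = (V - U) \<union> W" using that less.prems by blast
      moreover have "card (V - U) < card V" using that u less.prems by (intro psubset_card_mono) auto
      ultimately show ?thesis using less.hyps[of "V - U"] less.prems by auto
    qed
    have N: "nbrs E (V \<union> W) u = nbrs E V u" using less.prems u by auto
    have "matching_sum E (V \<union> W) x = x u * matching_sum E (V \<union> W - {u}) x
        - (\<Sum>w\<in>nbrs E V u. matching_sum E (V \<union> W - {u, w}) x)"
      using matching_sum_rec[OF E, of "V \<union> W" u x] u less.prems unfolding N by simp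
    also have "\<dots> = x u * (matching_sum E (V - {u}) x * matching_sum E W x)
        - (\<Sum>w\<in>nbrs E V u. matching_sum E (V - {u, w}) x * matching_sum E W x)"
      using u by (simp add: IH)
    also have "\<dots> = matching_sum E V x * matching_sum E W x"
      unfolding matching_sum_rec[OF E less.prems(1) u, of x]
      by (simp add: left_diff_distrib sum_distrib_right mult.assoc)
    finally show ?thesis .
  qed (use E in auto)
qed

text \<open>
  Expanding \<open>\<mu>(G)\<close> and \<open>\<mu>(G-v)\<close> at \<open>u\<close> writes \<open>\<mu>(G-u) \<mu>(G-v) - \<mu>(G) \<mu>(G-u-v)\<close> of the pair \<open>(u, v)\<close> in \<open>G\<close> as
  the sum of those of the pairs \<open>(w, v)\<close> in \<open>G-u\<close> over the neighbours \<open>w \<noteq> v\<close> of \<open>u\<close>, plus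
  \<open>\<mu>(G-u-v)\<^sup>2\<close> if \<open>u\<close> and \<open>v\<close> are adjacent.
\<close>

lemma matching_sum_Delta:
  fixes x :: "'a \<Rightarrow> real"
  assumes E: "loopless E" and "finite V" "u \<in> V" "v \<in> V" "u \<noteq> v"
  shows "(if {u, v} \<in> E then (matching_sum E (V - {u, v}) x)\<^sup>2 else 0) \<le>
    matching_sum E (V - {u}) x * matching_sum E (V - {v}) x
      - matching_sum E V x * matching_sum E (V - {u, v}) x"
  using assms(2-)
proof (induction "card V" arbitrary: V u rule: less_induct)
  case less
  let ?m = "\<lambda>U. matching_sum E (V - U) x"
  define N where "N = nbrs E V u - {v}"
  have finN: "finite N" using less.prems by (simp add: N_def)
  have IH: "0 \<le> ?m {u, w} * ?m {u, v} - ?m {u} * ?m {u, v, w}" if "w \<in> N" for w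
  proof -
    have "w \<noteq> u" "w \<in> V" "w \<noteq> v" using that loopless_neq[OF E] by (auto simp: N_def)
    then have "0 \<le> matching_sum E (V - {u} - {w}) x * matching_sum E (V - {u} - {v}) x
      - matching_sum E (V - {u}) x * matching_sum E (V - {u} - {w, v}) x"
      using less.hyps[of "V - {u}" w] less.prems
      by (smt (verit) Diff_iff card_Diff1_less finite_Diff insertE singletonD zero_le_power2)
    then show ?thesis by (simp add: Diff_insert2[symmetric] insert_commute)
  qed
  have V: "?m {} = x u * ?m {u} - (\<Sum>w\<in>nbrs E V u. ?m {u, w})"
    using matching_sum_rec[OF E less.prems(1,2), of x] by simp
  have Nv: "nbrs E (V - {v}) u = N" by (auto simp: N_def)
  have v: "?m {v} = x u * ?m {u, v} - (\<Sum>w\<in>N. ?m {u, v, w})"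
    using matching_sum_rec[OF E, of "V - {v}" u x] less.prems unfolding Nv
    by (simp add: Diff_insert2[symmetric] insert_commute)
  have split: "(\<Sum>w\<in>nbrs E V u. ?m {u, w}) = (\<Sum>w\<in>N. ?m {u, w}) + (if {u, v} \<in> E then ?m {u, v} else 0)"
  proof (cases "{u, v} \<in> E")
    case True
    then have "nbrs E V u = insert v N" using less.prems by (auto simp: N_def)
    moreover have "v \<notin> N" by (simp add: N_def)
    ultimately show ?thesis using True finN by simp
  next
    case False
    then have "nbrs E V u = N" by (auto simp: N_def)
    then show ?thesis using False by simp
  qed
  have "?m {u} * ?m {v} - ?m {} * ?m {u, v} =
      (\<Sum>w\<in>N. ?m {u, w} * ?m {u, v} - ?m {u} * ?m {u, v, w})
        + (if {u, v} \<in> E then (?m {u, v})\<^sup>2 else 0)"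
  proof -
    have "?m {u} * ?m {v} - ?m {} * ?m {u, v} = (\<Sum>w\<in>N. ?m {u, w}) * ?m {u, v}
        - ?m {u} * (\<Sum>w\<in>N. ?m {u, v, w}) + (if {u, v} \<in> E then ?m {u, v} else 0) * ?m {u, v}"
      unfolding v V split by (simp only: algebra_simps)
    then show ?thesis
      by (simp add: sum_distrib_left sum_distrib_right sum_subtractf power2_eq_square)
  qed
  moreover have "0 \<le> (\<Sum>w\<in>N. ?m {u, w} * ?m {u, v} - ?m {u} * ?m {u, v, w})"
    using IH by (rule sum_nonneg)
  ultimately show ?case by simp
qed

section \<open>Orders of vanishing\<close>

definition mpoly :: "'a set set \<Rightarrow> 'a set \<Rightarrow> real poly" where
  "mpoly E V = matching_sum E V (\<lambda>_. [:0, 1:])"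

lemma poly_mpoly: "poly (mpoly E V) t = matching_sum E V (\<lambda>_. t)"
  by (simp add: mpoly_def matching_sum_def poly_sum poly_prod)

lemma mpoly_empty [simp]: "loopless E \<Longrightarrow> mpoly E {} = 1"
  by (simp add: mpoly_def)

lemma mpoly_rec:
  "loopless E \<Longrightarrow> finite V \<Longrightarrow> u \<in> V \<Longrightarrow>
    mpoly E V = [:0, 1:] * mpoly E (V - {u}) - (\<Sum>w\<in>nbrs E V u. mpoly E (V - {u, w}))"
  unfolding mpoly_def by (rule matching_sum_rec)

text \<open>Only the first term of the recurrence reaches degree \<open>card V\<close>. The purpose
  is that \<open>mpoly E V\<close> is nonzero, so that its order of vanishing is meaningful.\<close>

lemma mpoly_degree_coeff:
  assumes E: "loopless E" and "finite V"
  shows "degree (mpoly E V) \<le> card V \<and> coeff (mpoly E V) (card V) = 1"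
  using assms(2)
proof (induction "card V" arbitrary: V rule: less_induct)
  case less
  show ?case
  proof (cases "V = {}")
    case False
    then obtain u where u: "u \<in> V" by blast
    then have card: "card V = Suc (card (V - {u}))" using less.prems by (metis card_Suc_Diff1)
    have "degree (mpoly E (V - {u, w})) < card V" if w: "w \<in> nbrs E V u" for w
    proof -
      have "V - {u, w} \<subset> V" using u by blast
      then have "card (V - {u, w}) < card V" using less.prems by (simp add: psubset_card_mono)
      then show ?thesis using less.hyps[of "V - {u, w}"] less.prems by auto
    qed
    then have S: "degree (\<Sum>w\<in>nbrs E V u. mpoly E (V - {u, w})) < card V"
      using card by (intro degree_sum_less) auto
    have IH: "degree (mpoly E (V - {u})) \<le> card (V - {u})" "coeff (mpoly E (V - {u})) (card (V - {u})) = 1"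
      using less.hyps[of "V - {u}"] less.prems card by auto
    have "degree (pCons 0 (mpoly E (V - {u}))) \<le> card V"
      using degree_pCons_le[of 0 "mpoly E (V - {u})"] IH(1) card by linarith
    then show ?thesis
      unfolding mpoly_rec[OF E less.prems u] using S IH(2)
      by (auto intro!: degree_diff_le simp: card coeff_eq_0)
  qed (use E in simp)
qed

lemma mpoly_nonzero: "loopless E \<Longrightarrow> finite V \<Longrightarrow> mpoly E V \<noteq> 0"
  using mpoly_degree_coeff[of E V] by auto

text \<open>When the recurrence at \<open>u\<close> is differentiated, the product rule contributes
  the summand for \<open>u\<close> itself; the rest regroups, by the deleted vertex
  \<open>v\<close>, into the recurrences of \<open>V - {v}\<close> at \<open>u\<close>.\<close>

lemma pderiv_mpoly:
  assumes E: "loopless E" and "finite V"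
  shows "pderiv (mpoly E V) = (\<Sum>v\<in>V. mpoly E (V - {v}))"
  using assms(2)
proof (induction "card V" arbitrary: V rule: less_induct)
  case less
  let ?p = "\<lambda>U. mpoly E (V - U)"
  show ?case
  proof (cases "V = {}")
    case False
    then obtain u where u: "u \<in> V" by blast
    define W where "W = V - {u}"
    define N where "N = nbrs E V u"
    have fin: "finite W" "finite N" using less.prems by (auto simp: W_def N_def)
    have IH: "pderiv (?p U) = (\<Sum>v\<in>V - U. ?p (insert v U))" if "u \<in> U" for U
    proof -
      have "V - U \<subset> V" using u that by blast
      then have "card (V - U) < card V" using less.prems by (simp add: psubset_card_mono)
      then show ?thesis using less.hyps[of "V - U"] less.prems by (simp add: Diff_insert[symmetric])
    qed
    have rec: "?p {v} = [:0, 1:] * ?p {v, u} - (\<Sum>w\<in>N - {v}. ?p {v, u, w})" if "v \<in> W" for v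
    proof -
      have "nbrs E (V - {v}) u = N - {v}" by (auto simp: N_def)
      then show ?thesis
        using mpoly_rec[OF E, of "V - {v}" u] less.prems u that
        by (auto simp: W_def Diff_insert2[symmetric])
    qed
    have "(\<Sum>w\<in>N. \<Sum>v\<in>V - {u, w}. ?p {v, u, w}) = (\<Sum>w\<in>N. \<Sum>v\<in>{v \<in> W. v \<noteq> w}. ?p {v, u, w})"
      by (intro sum.cong) (auto simp: W_def)
    also have "\<dots> = (\<Sum>v\<in>W. \<Sum>w\<in>{w \<in> N. v \<noteq> w}. ?p {v, u, w})"
      using fin by (intro sum.swap_restrict)
    also have "\<dots> = (\<Sum>v\<in>W. \<Sum>w\<in>N - {v}. ?p {v, u, w})"
      by (intro sum.cong) auto
    finally have swap: "(\<Sum>w\<in>N. \<Sum>v\<in>V - {u, w}. ?p {v, u, w}) = (\<Sum>v\<in>W. \<Sum>w\<in>N - {v}. ?p {v, u, w})" .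
    have "pderiv (mpoly E V) = ?p {u} + [:0, 1:] * (\<Sum>v\<in>W. ?p {v, u})
        - (\<Sum>w\<in>N. \<Sum>v\<in>V - {u, w}. ?p {v, u, w})"
      unfolding mpoly_rec[OF E less.prems u]
      by (simp add: pderiv_diff higher_pderiv_sum[of 1, simplified] pderiv_mult pderiv_pCons IH N_def W_def)
    also have "\<dots> = ?p {u} + (\<Sum>v\<in>W. ?p {v})"
      unfolding swap by (simp add: rec sum_subtractf sum_distrib_left)
    also have "\<dots> = (\<Sum>v\<in>V. ?p {v})"
      using less.prems u by (simp add: W_def sum.remove)
    finally show ?thesis .
  qed (use E in simp)
qed

section \<open>Polynomial inequalities and orders of vanishing\<close>

lemma poly_ge_0_right:
  fixes p :: "real poly"
  assumes "\<And>t. \<theta> < t \<Longrightarrow> 0 \<le> poly p t"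
  shows "0 \<le> poly p \<theta>"
proof (rule tendsto_lowerbound)
  show "(poly p \<longlongrightarrow> poly p \<theta>) (at_right \<theta>)"
    by (intro tendsto_intros)
  show "\<forall>\<^sub>F t in at_right \<theta>. 0 \<le> poly p t"
    by (rule eventually_at_rightI[of _ "\<theta> + 1"]) (use assms in auto)
qed simp

lemma poly_le_0_left:
  fixes p :: "real poly"
  assumes "\<And>t. t < \<theta> \<Longrightarrow> poly p t \<le> 0"
  shows "poly p \<theta> \<le> 0"
proof (rule tendsto_upperbound)
  show "(poly p \<longlongrightarrow> poly p \<theta>) (at_left \<theta>)"
    by (intro tendsto_intros)
  show "\<forall>\<^sub>F t in at_left \<theta>. poly p t \<le> 0"
    by (rule eventually_at_leftI[of "\<theta> - 1"]) (use assms in auto)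
qed simp

text \<open>The cofactor of the odd power is nonnegative to the right of \<theta> and nonpositive to
  the left, so it vanishes at \<theta> and yields one more factor.\<close>

lemma nonneg_poly_dvd_even:
  fixes D :: "real poly"
  assumes nonneg: "\<And>t. 0 \<le> poly D t" and "[:-\<theta>, 1:] ^ (2 * j + 1) dvd D"
  shows "[:-\<theta>, 1:] ^ (2 * j + 2) dvd D"
proof -
  obtain R where D: "D = [:-\<theta>, 1:] ^ (2 * j + 1) * R" using assms(2) by (elim dvdE)
  have R: "0 \<le> (t - \<theta>) * ((t - \<theta>) ^ j)\<^sup>2 * poly R t" for t
  proof -
    have "poly [:-\<theta>, 1:] t = t - \<theta>" by simp
    then show ?thesis
      using nonneg[of t] unfolding D poly_mult poly_power
      by (simp only: power_add power_mult power_one_right power2_eq_square power_mult_distrib ac_simps)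
  qed
  have "0 \<le> poly R t" if "\<theta> < t" for t
  proof -
    have "0 < (t - \<theta>) * ((t - \<theta>) ^ j)\<^sup>2" using that by simp
    then show ?thesis
      using R[of t] zero_le_mult_iff[of "(t - \<theta>) * ((t - \<theta>) ^ j)\<^sup>2" "poly R t"] by linarith
  qed
  then have "0 \<le> poly R \<theta>" by (rule poly_ge_0_right)
  moreover have "poly R t \<le> 0" if "t < \<theta>" for t
  proof -
    have "(t - \<theta>) * ((t - \<theta>) ^ j)\<^sup>2 < 0" using that by (intro mult_neg_pos) auto
    then show ?thesis
      using R[of t] zero_le_mult_iff[of "(t - \<theta>) * ((t - \<theta>) ^ j)\<^sup>2" "poly R t"] by linarith
  qed
  then have "poly R \<theta> \<le> 0" by (rule poly_le_0_left)
  ultimately have "[:-\<theta>, 1:] dvd R" by (simp add: poly_eq_0_iff_dvd[symmetric])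
  then have "[:-\<theta>, 1:] ^ (2 * j + 1) * [:-\<theta>, 1:] dvd D"
    unfolding D by (intro mult_dvd_mono dvd_refl)
  then show ?thesis by (simp only: power_add power_one_right mult_1_right mult.assoc one_add_one[symmetric])
qed

text \<open>If \<open>q\<close> had order \<open>i < j\<close>, dividing the inequality by
  \<open>(t - \<theta>) ^ (2 * i)\<close> and letting \<open>t\<close> tend to \<theta> from the
  right would bound the square of a nonzero number by 0. The odd exponent suffices, as
  \<open>2 * i + 1 \<le> 2 * j - 1\<close>.\<close>

lemma square_le_poly_dvd:
  fixes D q :: "real poly"
  assumes le: "\<And>t. (poly q t)\<^sup>2 \<le> poly D t" and D: "[:-\<theta>, 1:] ^ (2 * j - 1) dvd D"
  shows "[:-\<theta>, 1:] ^ j dvd q"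
proof (rule ccontr)
  assume n: "\<not> [:-\<theta>, 1:] ^ j dvd q"
  then have q0: "q \<noteq> 0" by auto
  define i where "i = order \<theta> q"
  have ij: "i < j" using n q0 by (simp add: order_divides i_def)
  obtain R where q: "q = [:-\<theta>, 1:] ^ i * R" and R: "poly R \<theta> \<noteq> 0"
    using order_decomp[OF q0, of \<theta>] by (auto simp: i_def poly_eq_0_iff_dvd)
  have "2 * i + 1 \<le> 2 * j - 1" using ij by simp
  then have "[:-\<theta>, 1:] ^ (2 * i + 1) dvd D" using D by (meson dvd_trans le_imp_power_dvd)
  then obtain S where S: "D = [:-\<theta>, 1:] ^ (2 * i + 1) * S" by (elim dvdE)
  have "0 \<le> poly ([:-\<theta>, 1:] * S - R\<^sup>2) t" if "\<theta> < t" for t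
  proof -
    have "((t - \<theta>) ^ i)\<^sup>2 * (poly R t)\<^sup>2 \<le> ((t - \<theta>) ^ i)\<^sup>2 * ((t - \<theta>) * poly S t)"
    proof -
      have "poly [:-\<theta>, 1:] t = t - \<theta>" by simp
      then show ?thesis
        using le[of t] unfolding q S poly_mult poly_power
        by (simp only: power_add power_mult power_one_right power2_eq_square power_mult_distrib ac_simps)
    qed
    then have "(poly R t)\<^sup>2 \<le> (t - \<theta>) * poly S t"
      by (rule mult_left_le_imp_le) (use that in simp)
    then show ?thesis by (simp add: poly_power algebra_simps)
  qed
  then have "0 \<le> poly ([:-\<theta>, 1:] * S - R\<^sup>2) \<theta>" by (rule poly_ge_0_right)
  then show False using R by (simp add: poly_power)
qed

lemma power_dvd_pderiv:
  fixes p :: "real poly"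
  assumes "[:-\<theta>, 1:] ^ n dvd p"
  shows "[:-\<theta>, 1:] ^ (n - 1) dvd pderiv p"
proof (cases n)
  case (Suc k)
  define L where "L = [:-\<theta>, 1:]"
  obtain r where p: "p = L ^ Suc k * r" using assms unfolding Suc L_def by (elim dvdE)
  have "pderiv p = L ^ k * (smult (of_nat (Suc k)) (pderiv L) * r + L * pderiv r)"
    unfolding p pderiv_mult pderiv_power_Suc by (simp add: algebra_simps)
  then have "L ^ k dvd pderiv p" by (rule dvdI)
  then show ?thesis using Suc by (simp add: L_def)
qed simp

section \<open>Vertex types\<close>

text \<open>Multiplicity and vertex types as functions of the vertex set;
  \<open>mult_eq_root_mult\<close> and \<open>graph_vertex_types\<close> lead back to
  graphs.\<close>

definition root_mult :: "real \<Rightarrow> 'a set set \<Rightarrow> 'a set \<Rightarrow> nat" where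
  "root_mult \<theta> E V = order \<theta> (mpoly E V)"

definition ess :: "real \<Rightarrow> 'a set set \<Rightarrow> 'a set \<Rightarrow> 'a \<Rightarrow> bool" where
  "ess \<theta> E V u \<longleftrightarrow> u \<in> V \<and> root_mult \<theta> E V = Suc (root_mult \<theta> E (V - {u}))"

definition pos :: "real \<Rightarrow> 'a set set \<Rightarrow> 'a set \<Rightarrow> 'a \<Rightarrow> bool" where
  "pos \<theta> E V u \<longleftrightarrow> u \<in> V \<and> root_mult \<theta> E (V - {u}) = Suc (root_mult \<theta> E V)"

definition spec :: "real \<Rightarrow> 'a set set \<Rightarrow> 'a set \<Rightarrow> 'a \<Rightarrow> bool" where
  "spec \<theta> E V u \<longleftrightarrow> u \<in> V \<and> \<not> ess \<theta> E V u \<and> (\<exists>y. {u, y} \<in> E \<and> ess \<theta> E V y)"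

text \<open>Vertex sets stay variable, so deletions remain inside the locale; it is later
  interpreted for two edge sets at once.\<close>

locale matching_root =
  fixes E :: "'a set set" and \<theta> :: real
  assumes E: "loopless E"
begin

abbreviation p where "p \<equiv> mpoly E"
abbreviation \<nu> where "\<nu> \<equiv> root_mult \<theta> E"
abbreviation L where "L \<equiv> [:-\<theta>, 1:]"

lemma power_dvd_p_iff: "finite V \<Longrightarrow> L ^ n dvd p V \<longleftrightarrow> n \<le> \<nu> V"
  using mpoly_nonzero[OF E] by (simp add: root_mult_def order_divides)

lemma power_dvd_prod_iff: "finite V \<Longrightarrow> finite W \<Longrightarrow> L ^ n dvd p V * p W \<longleftrightarrow> n \<le> \<nu> V + \<nu> W"
  using mpoly_nonzero[OF E] by (simp add: root_mult_def order_divides order_mult)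

lemma root_mult_union:
  assumes "finite V" "finite W" "V \<inter> W = {}" "\<And>v w. v \<in> V \<Longrightarrow> w \<in> W \<Longrightarrow> {v, w} \<notin> E"
  shows "\<nu> (V \<union> W) = \<nu> V + \<nu> W"
proof -
  have "p (V \<union> W) = p V * p W" unfolding mpoly_def by (rule matching_sum_union[OF E assms])
  then show ?thesis using mpoly_nonzero[OF E] assms(1,2) by (simp add: root_mult_def order_mult)
qed

text \<open>For distinct \<open>u\<close> and \<open>v\<close> in a finite \<open>V\<close> this is,
  by the Heilmann-Lieb identity, the sum of the squares of \<open>p (V - P)\<close> over the vertex
  sets \<open>P\<close> of the paths from \<open>u\<close> to \<open>v\<close>. Only its
  nonnegativity and the contribution of an edge \<open>{u, v}\<close> enter below.\<close>

definition \<Delta> :: "'a set \<Rightarrow> 'a \<Rightarrow> 'a \<Rightarrow> real poly" where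
  "\<Delta> V u v = p (V - {u}) * p (V - {v}) - p V * p (V - {u, v})"

section \<open>Interlacing\<close>

lemma poly_Delta_nonneg:
  "finite V \<Longrightarrow> u \<in> V \<Longrightarrow> v \<in> V \<Longrightarrow> u \<noteq> v \<Longrightarrow> 0 \<le> poly (\<Delta> V u v) t"
  using order_trans[OF _ matching_sum_Delta[OF E, of V u v "\<lambda>_. t"], of 0]
  by (simp add: \<Delta>_def poly_mpoly)

lemma poly_Delta_ge_square:
  "finite V \<Longrightarrow> u \<in> V \<Longrightarrow> v \<in> V \<Longrightarrow> {u, v} \<in> E \<Longrightarrow> (poly (p (V - {u, v})) t)\<^sup>2 \<le> poly (\<Delta> V u v) t"
  using matching_sum_Delta[OF E, of V u v "\<lambda>_. t"] loopless_neq[OF E, of u v]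
  by (simp add: \<Delta>_def poly_mpoly)

lemma power_dvd_Delta:
  "finite V \<Longrightarrow> n \<le> \<nu> (V - {u}) + \<nu> (V - {v}) \<Longrightarrow> n \<le> \<nu> V + \<nu> (V - {u, v}) \<Longrightarrow> L ^ n dvd \<Delta> V u v"
  by (simp add: \<Delta>_def dvd_diff power_dvd_prod_iff del: mult_pCons_left mult_pCons_right)

text \<open>Both products in \<Delta> vanish to order \<open>2 * j - 1\<close>, and \<Delta>
  dominates the square of \<open>p (V - {u, v})\<close>.\<close>

lemma edge_bound:
  assumes "finite V" "u \<in> V" "v \<in> V" "{u, v} \<in> E"
    and "2 * j \<le> Suc (\<nu> (V - {u}) + \<nu> (V - {v}))" "2 * j \<le> Suc (\<nu> V + \<nu> (V - {u, v}))"
  shows "j \<le> \<nu> (V - {u, v})"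
proof -
  have "L ^ (2 * j - 1) dvd \<Delta> V u v" using assms by (intro power_dvd_Delta) auto
  then have "L ^ j dvd p (V - {u, v})"
    using square_le_poly_dvd[OF poly_Delta_ge_square] assms(1-4) by blast
  then show ?thesis using assms(1) by (simp add: power_dvd_p_iff)
qed

text \<open>By the derivative formula, the Wronskian \<open>W\<close> of the two polynomials
  dominates the square of \<open>p (V - {u})\<close>. A drop by two or more would make
  \<open>W\<close> vanish to order \<open>2 * \<nu> (V - {u}) + 1\<close>, and then
  \<open>p (V - {u})\<close> to a higher order than it does.\<close>

lemma root_mult_le_Suc_delete:
  assumes fin: "finite V" and u: "u \<in> V"
  shows "\<nu> V \<le> Suc (\<nu> (V - {u}))"
proof (rule ccontr)
  assume "\<not> ?thesis"
  then have less: "Suc (Suc (\<nu> (V - {u}))) \<le> \<nu> V" by simp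
  define W where "W = p (V - {u}) * pderiv (p V) - p V * pderiv (p (V - {u}))"
  have "W = (p (V - {u}))\<^sup>2 + (\<Sum>v\<in>V - {u}. \<Delta> V u v)"
    unfolding W_def pderiv_mpoly[OF E fin] pderiv_mpoly[OF E finite_Diff[OF fin]] sum.remove[OF fin u]
    by (simp add: \<Delta>_def Diff_insert2[symmetric] algebra_simps sum_distrib_left sum_subtractf
        power2_eq_square)
  then have W: "(poly (p (V - {u})) t)\<^sup>2 \<le> poly W t" for t
    using poly_Delta_nonneg[OF fin u] by (auto simp: poly_sum intro!: sum_nonneg)
  have "L ^ (\<nu> (V - {u}) + (\<nu> V - 1)) dvd p (V - {u}) * pderiv (p V)"
    unfolding power_add using fin by (intro mult_dvd_mono power_dvd_pderiv) (simp_all add: power_dvd_p_iff)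
  moreover have "L ^ (\<nu> V + (\<nu> (V - {u}) - 1)) dvd p V * pderiv (p (V - {u}))"
    unfolding power_add using fin by (intro mult_dvd_mono power_dvd_pderiv) (simp_all add: power_dvd_p_iff)
  ultimately have "L ^ (2 * Suc (\<nu> (V - {u})) - 1) dvd W"
    unfolding W_def by (intro dvd_diff; elim power_le_dvd) (use less in simp_all)
  from square_le_poly_dvd[OF W this] show False
    using fin by (simp add: power_dvd_p_iff del: power_Suc)
qed

text \<open>By the other half of interlacing, used in \<open>V - {u}\<close>, every term of the
  recurrence at \<open>u\<close> vanishes to order \<open>\<nu> (V - {u}) - 1\<close>.\<close>

lemma delete_root_mult_le_Suc:
  assumes fin: "finite V" and u: "u \<in> V"
  shows "\<nu> (V - {u}) \<le> Suc (\<nu> V)"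
proof -
  let ?n = "\<nu> (V - {u})"
  have "L ^ (?n - 1) dvd p (V - {u, w})" if "w \<in> nbrs E V u" for w
  proof -
    have "w \<in> V - {u}" using that loopless_neq[OF E] by auto
    then show ?thesis
      using root_mult_le_Suc_delete[of "V - {u}" w] fin
      by (auto simp: power_dvd_p_iff Diff_insert2[symmetric])
  qed
  moreover have "L ^ (?n - 1) dvd p (V - {u})" using fin by (simp add: power_dvd_p_iff)
  ultimately have "L ^ (?n - 1) dvd p V"
    unfolding mpoly_rec[OF E fin u] by (intro dvd_diff dvd_mult dvd_sum)
  then show ?thesis using fin by (simp add: power_dvd_p_iff)
qed

text \<open>The derivative is the sum of all \<open>p (V - {v})\<close> and has order exactly
  \<open>\<nu> V - 1\<close>, so some summand has order below \<open>\<nu> V\<close>.\<close>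

lemma ess_exists:
  assumes fin: "finite V" and pos: "0 < \<nu> V"
  obtains v where "ess \<theta> E V v"
proof (rule ccontr)
  assume "\<not> thesis"
  then have nE: "\<not> ess \<theta> E V v" for v using that by blast
  have "\<nu> V \<le> \<nu> (V - {v})" if "v \<in> V" for v
    using root_mult_le_Suc_delete[OF fin that] nE[of v] that by (auto simp: ess_def)
  then have "L ^ \<nu> V dvd pderiv (p V)"
    unfolding pderiv_mpoly[OF E fin] using fin by (intro dvd_sum) (simp add: power_dvd_p_iff)
  moreover have "pderiv (p V) \<noteq> 0"
  proof
    assume "pderiv (p V) = 0"
    then have "degree (p V) = 0" by (simp add: pderiv_eq_0_iff)
    then obtain c where "p V = [:c:]" by (elim degree_eq_zeroE)
    then show False using pos mpoly_nonzero[OF E fin] by (auto simp: root_mult_def order_0I)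
  qed
  ultimately have "\<nu> V \<le> order \<theta> (pderiv (p V))" by (simp add: order_divides)
  moreover have "\<nu> V = Suc (order \<theta> (pderiv (p V)))"
    unfolding root_mult_def
    by (rule order_pderiv) (use mpoly_nonzero[OF E fin] pos in \<open>auto simp: root_mult_def order_root\<close>)
  ultimately show False by simp
qed

section \<open>The neighbour criterion for positive vertices\<close>

lemma delete_swap:
  "V - {u} - {v} = V - {u, v}" "V - {u} - {v, w} = V - {u, v, w}" "V - {u, v} - {w} = V - {u, v, w}"
  by auto

text \<open>Otherwise \<open>\<nu> (V - {w}) \<le> \<nu> V\<close>, and \<open>edge_bound\<close> at
  the edge \<open>{w, y}\<close> would make \<open>\<nu> (V - {w, y})\<close> larger than
  itself.\<close>

lemma pos_if_nbr_ess_deleted: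
  assumes fin: "finite V" and V: "w \<in> V" and wy: "{w, y} \<in> E" and ess: "ess \<theta> E (V - {w}) y"
  shows "pos \<theta> E V w"
proof (rule ccontr)
  assume nP: "\<not> pos \<theta> E V w"
  have y: "y \<in> V" "y \<noteq> w" and k: "\<nu> (V - {w}) = Suc (\<nu> (V - {w, y}))"
    using ess by (auto simp: ess_def delete_swap)
  have "Suc (\<nu> (V - {w, y})) \<le> \<nu> V"
    using nP V k delete_root_mult_le_Suc[OF fin V] by (auto simp: pos_def)
  then have "Suc (\<nu> (V - {w, y})) \<le> \<nu> (V - {w, y})"
    using k root_mult_le_Suc_delete[OF fin y(1)] by (intro edge_bound[OF fin V y(1) wy]) auto
  then show False by simp
qed

text \<open>If no neighbour were essential in \<open>V - {w}\<close>, every term of the recurrence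
  at \<open>w\<close>, hence \<open>p V\<close>, would vanish to order
  \<open>\<nu> V + 1\<close>.\<close>

lemma pos_imp_nbr_ess_deleted:
  assumes fin: "finite V" and P: "pos \<theta> E V w"
  obtains y where "{w, y} \<in> E" "ess \<theta> E (V - {w}) y"
proof (rule ccontr)
  assume "\<not> thesis"
  then have nE: "{w, y} \<in> E \<Longrightarrow> \<not> ess \<theta> E (V - {w}) y" for y using that by blast
  have w: "w \<in> V" and k: "\<nu> (V - {w}) = Suc (\<nu> V)" using P by (auto simp: pos_def)
  have "L ^ Suc (\<nu> V) dvd p (V - {w, y})" if y: "y \<in> nbrs E V w" for y
  proof -
    have "y \<in> V - {w}" using y loopless_neq[OF E] by auto
    then have "Suc (\<nu> V) \<le> \<nu> (V - {w, y})"
      using root_mult_le_Suc_delete[of "V - {w}" y] fin k nE[of y] y by (auto simp: ess_def delete_swap)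
    then show ?thesis using fin by (simp add: power_dvd_p_iff del: power_Suc)
  qed
  moreover have "L ^ Suc (\<nu> V) dvd p (V - {w})"
    using fin k by (simp add: power_dvd_p_iff del: power_Suc)
  ultimately have "L ^ Suc (\<nu> V) dvd p V"
    unfolding mpoly_rec[OF E fin w] by (intro dvd_diff dvd_mult dvd_sum)
  then show False using fin by (simp add: power_dvd_p_iff del: power_Suc)
qed

text \<open>A parity argument: if \<open>y\<close> were not essential in \<open>V - {w}\<close>,
  interlacing would give \<open>\<nu> (V - {w}) = \<nu> (V - {w, y}) = \<nu> V\<close>. The products
  in \<Delta> would then have orders \<open>2 * \<nu> V - 1\<close> and \<open>2 * \<nu> V\<close>,
  so the nonnegative \<Delta> would have odd order.\<close>

lemma spec_nbr_ess_deleted: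
  assumes fin: "finite V" and w: "w \<in> V" and nE: "\<not> ess \<theta> E V w"
    and wy: "{w, y} \<in> E" and y: "ess \<theta> E V y"
  shows "ess \<theta> E (V - {w}) y"
proof (rule ccontr)
  assume nEy: "\<not> ess \<theta> E (V - {w}) y"
  have yV: "y \<in> V" "y \<noteq> w" and k: "\<nu> V = Suc (\<nu> (V - {y}))"
    using y nE by (auto simp: ess_def)
  have w1: "\<nu> V \<le> \<nu> (V - {w})"
    using root_mult_le_Suc_delete[OF fin w] nE w by (auto simp: ess_def)
  have wy1: "\<nu> (V - {w}) \<le> \<nu> (V - {w, y})"
    using nEy root_mult_le_Suc_delete[of "V - {w}" y] fin yV by (auto simp: ess_def delete_swap)
  have "\<nu> (V - {w, y}) \<le> \<nu> V"
    using delete_root_mult_le_Suc[of "V - {y}" w] fin w yV k by (auto simp: delete_swap insert_commute)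
  then have eq: "\<nu> (V - {w}) = \<nu> V" "\<nu> (V - {w, y}) = \<nu> V" using w1 wy1 by auto
  have "L ^ (2 * \<nu> (V - {y}) + 1) dvd \<Delta> V w y"
    using eq k fin by (intro power_dvd_Delta) auto
  then have "L ^ (2 * \<nu> (V - {y}) + 2) dvd \<Delta> V w y"
    by (rule nonneg_poly_dvd_even[OF poly_Delta_nonneg[OF fin w yV(1) yV(2)[symmetric]]])
  moreover have "L ^ (2 * \<nu> (V - {y}) + 2) dvd p V * p (V - {w, y})"
    using eq k fin by (subst power_dvd_prod_iff) auto
  ultimately have "L ^ (2 * \<nu> (V - {y}) + 2) dvd \<Delta> V w y + p V * p (V - {w, y})" by (rule dvd_add)
  then have "L ^ (2 * \<nu> (V - {y}) + 2) dvd p (V - {w}) * p (V - {y})" by (simp add: \<Delta>_def)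
  then show False using eq k fin by (subst (asm) power_dvd_prod_iff) auto
qed

lemma spec_imp_pos: "finite V \<Longrightarrow> spec \<theta> E V w \<Longrightarrow> pos \<theta> E V w"
  unfolding spec_def by (meson pos_if_nbr_ess_deleted spec_nbr_ess_deleted)

text \<open>
  Use the inequality for the pair \<open>(a, b)\<close> with weight \<open>t + l (t - \<theta>)\<close> at \<open>c\<close> and \<open>t\<close> elsewhere. If the
  conclusion failed, its leading coefficient at \<open>\<theta>\<close> would be a nonconstant affine function of \<open>l\<close>,
  hence negative for some \<open>l\<close>.
\<close>

lemma parallel_trans:
  assumes fin: "finite V" and V: "a \<in> V" "b \<in> V" "c \<in> V" and ne: "a \<noteq> b" "b \<noteq> c" "a \<noteq> c"
    and b: "ess \<theta> E V b" and k: "\<nu> V = Suc n"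
    and ab: "n \<le> \<nu> (V - {a, b})" and bc: "n \<le> \<nu> (V - {b, c})"
  shows "n \<le> \<nu> (V - {a, c})"
proof (rule ccontr)
  assume ac: "\<not> ?thesis"
  then obtain m where n: "n = Suc m" by (cases n) auto
  have \<nu>: "n \<le> \<nu> (V - {a})" "\<nu> (V - {b}) = n" "n \<le> \<nu> (V - {c})"
    using root_mult_le_Suc_delete[OF fin V(1)] root_mult_le_Suc_delete[OF fin V(3)] k b
    by (auto simp: ess_def)
  have "m \<le> \<nu> (V - {a, c})"
    using root_mult_le_Suc_delete[of "V - {a}" c] fin V ne \<nu> n by (simp add: delete_swap)
  moreover have "m \<le> \<nu> (V - {a, b, c})"
    using root_mult_le_Suc_delete[of "V - {a, b}" c] fin V ne ab n by (simp add: delete_swap)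
  ultimately have "L ^ Suc n dvd p V" "L ^ n dvd p (V - {a})" "L ^ n dvd p (V - {b})"
    "L ^ n dvd p (V - {c})" "L ^ n dvd p (V - {a, b})" "L ^ n dvd p (V - {b, c})"
    "L ^ m dvd p (V - {a, c})" "L ^ m dvd p (V - {a, b, c})"
    using k \<nu> ab bc fin by (simp_all add: power_dvd_p_iff del: power_Suc)
  then obtain f0 fa fb fc fab fbc fac fabc where f:
    "p V = L ^ Suc n * f0" "p (V - {a}) = L ^ n * fa" "p (V - {b}) = L ^ n * fb"
    "p (V - {c}) = L ^ n * fc" "p (V - {a, b}) = L ^ n * fab" "p (V - {b, c}) = L ^ n * fbc"
    "p (V - {a, c}) = L ^ m * fac" "p (V - {a, b, c}) = L ^ m * fabc"
    by (elim dvdE)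
  have root: "L ^ Suc i dvd L ^ i * g" if "poly g \<theta> = 0" for i g
  proof -
    have "L dvd g" using that by (simp add: poly_eq_0_iff_dvd)
    then show ?thesis by (simp only: power_Suc2 mult_dvd_mono dvd_refl)
  qed
  \<comment> \<open>The orders are exact here: \<open>\<nu> (V - {b}) = n\<close>, and
    \<open>\<nu> (V - {a, c}) = m\<close> by the assumed failure.\<close>
  have fb: "poly fb \<theta> \<noteq> 0"
    using root[of fb n] \<nu>(2) fin by (auto simp: f(3)[symmetric] power_dvd_p_iff simp del: power_Suc)
  have fac: "poly fac \<theta> \<noteq> 0"
    using root[of fac m] ac n fin by (auto simp: f(7)[symmetric] power_dvd_p_iff simp del: power_Suc)
  have "0 \<le> (poly fa \<theta> + l * poly fac \<theta>) * poly fb \<theta>" for l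
  proof -
    \<comment> \<open>\<open>B\<close> is what remains of the difference for the pair
      \<open>(a, b)\<close> after division by \<open>(t - \<theta>) ^ (2 * n)\<close>, when the
      weight of \<open>c\<close> is raised by \<open>l * (t - \<theta>)\<close>.\<close>
    define B where "B = (fa + [:l:] * fac) * (fb + [:l:] * L * fbc) - L * (f0 + [:l:] * fc) * (fab + [:l:] * fabc)"
    have "0 \<le> poly B t" if "\<theta> < t" for t
    proof -
      define s where "s = l * (t - \<theta>)"
      have Lt: "poly L t = t - \<theta>" by simp
      have shift: "matching_sum E (V - U) ((\<lambda>_. t)(c := t + s)) = poly (p (V - U)) t + s * poly (p (V - insert c U)) t"
        if "c \<notin> U" for U
        using matching_sum_shift[OF E, of "V - U" c "\<lambda>_. t" s] fin V that
        by (simp add: poly_mpoly Diff_insert[symmetric])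
      have "0 \<le> (poly (p (V - {a})) t + s * poly (p (V - {a, c})) t) * (poly (p (V - {b})) t + s * poly (p (V - {b, c})) t)
        - (poly (p V) t + s * poly (p (V - {c})) t) * (poly (p (V - {a, b})) t + s * poly (p (V - {a, b, c})) t)"
        using order_trans[OF _ matching_sum_Delta[OF E fin V(1,2) ne(1), of "(\<lambda>_. t)(c := t + s)"], of 0]
          shift[of "{}"] shift[of "{a}"] shift[of "{b}"] shift[of "{a, b}"] ne
        by (simp add: insert_commute)
      also have "\<dots> = ((t - \<theta>) ^ n)\<^sup>2 * poly B t"
        unfolding f B_def n s_def poly_mult poly_power Lt poly_add poly_diff
        by (simp add: algebra_simps power2_eq_square)
      finally show ?thesis using that by (simp add: zero_le_mult_iff)
    qed
    then have "0 \<le> poly B \<theta>" by (rule poly_ge_0_right)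
    then show ?thesis by (simp add: B_def)
  qed
  \<comment> \<open>This \<open>l\<close> makes the expression equal to -1.\<close>
  from this[of "- (poly fa \<theta> * poly fb \<theta> + 1) / (poly fac \<theta> * poly fb \<theta>)"]
  show False using fb fac by (simp add: field_simps)
qed

section \<open>Stability under deletion of a special vertex\<close>

lemma pos_ess_delete:
  assumes fin: "finite V" and w: "pos \<theta> E V w" and x: "ess \<theta> E V x"
  shows "ess \<theta> E (V - {w}) x" "pos \<theta> E (V - {x}) w"
proof -
  have "w \<noteq> x" using w x by (auto simp: pos_def ess_def)
  \<comment> \<open>Interlacing along the two orders of deletion leaves only
    \<open>\<nu> (V - {w, x}) = \<nu> V\<close>.\<close>
  then show "ess \<theta> E (V - {w}) x" "pos \<theta> E (V - {x}) w"
    using w x fin root_mult_le_Suc_delete[of "V - {w}" x] delete_root_mult_le_Suc[of "V - {x}" w]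
    by (auto simp: pos_def ess_def delete_swap insert_commute)
qed

text \<open>One direction is \<open>pos_ess_delete\<close>. For the other, suppose \<open>x\<close>
  becomes essential only when \<open>w\<close> is deleted. Then \<open>w\<close> is not positive in
  \<open>V - {x}\<close>, so by the criterion every other neighbour of \<open>w\<close> is parallel
  to \<open>x\<close> in \<open>V - {w}\<close>. Two neighbours that are not parallel to each other
  contradict \<open>parallel_trans\<close>.\<close>

lemma ess_delete_spec:
  assumes fin: "finite V" and w: "spec \<theta> E V w" and xw: "x \<noteq> w"
  shows "ess \<theta> E (V - {w}) x \<longleftrightarrow> ess \<theta> E V x"
proof
  assume "ess \<theta> E V x"
  then show "ess \<theta> E (V - {w}) x" using pos_ess_delete(1)[OF fin] spec_imp_pos[OF fin w] by blast
next
  assume x: "ess \<theta> E (V - {w}) x"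
  show "ess \<theta> E V x"
  proof (rule ccontr)
    assume nE: "\<not> ess \<theta> E V x"
    have P: "pos \<theta> E V w" by (rule spec_imp_pos[OF fin w])
    obtain y where wV: "w \<in> V" "\<not> ess \<theta> E V w" and y: "{w, y} \<in> E" "ess \<theta> E V y"
      using w unfolding spec_def by blast
    \<comment> \<open>Deleting \<open>y\<close> keeps \<open>w\<close> positive, so the criterion in
      \<open>V - {y}\<close> supplies a second neighbour.\<close>
    obtain v where v: "{w, v} \<in> E" "ess \<theta> E (V - {y} - {w}) v"
      using pos_imp_nbr_ess_deleted[OF _ pos_ess_delete(2)[OF fin P y(2)]] fin by blast
    have xV: "x \<in> V" and K: "\<nu> (V - {w}) = Suc (\<nu> V)" and Kx: "\<nu> (V - {w, x}) = \<nu> V"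
      using x P by (auto simp: ess_def pos_def delete_swap)
    have "\<not> pos \<theta> E (V - {x}) w"
      using root_mult_le_Suc_delete[OF fin xV] nE xV Kx
      by (auto simp: pos_def ess_def delete_swap insert_commute)
    then have nz: "\<not> ess \<theta> E (V - {x} - {w}) z" if "{w, z} \<in> E" for z
      using pos_if_nbr_ess_deleted[of "V - {x}" w z] fin wV xw that by auto
    have z: "\<nu> V \<le> \<nu> (V - {w, x, z})" if "{w, z} \<in> E" "z \<in> V" "z \<noteq> x" for z
    proof -
      have "z \<noteq> w" using loopless_neq[OF E that(1)] by simp
      then show ?thesis
        using nz[OF that(1)] root_mult_le_Suc_delete[of "V - {w, x}" z] fin that Kx
        by (auto simp: ess_def delete_swap insert_commute)
    qed
    have yV: "y \<in> V" "y \<noteq> w" "y \<noteq> x" using y(2) wV nE by (auto simp: ess_def)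
    have vV: "v \<in> V" "v \<noteq> w" "v \<noteq> y" and wyv: "Suc (\<nu> (V - {w, y, v})) = \<nu> (V - {w, y})"
      using v(2) by (auto simp: ess_def delete_swap insert_commute)
    have "\<nu> (V - {w, y}) = \<nu> V"
      using pos_ess_delete(1)[OF fin P y(2)] K by (simp add: ess_def delete_swap)
    with wyv have less: "\<nu> (V - {w, y, v}) < \<nu> V" by simp
    have "v \<noteq> x" using less z[OF y(1) yV(1,3)] by (auto simp: insert_commute)
    \<comment> \<open>\<open>y\<close> and \<open>v\<close> are both parallel to \<open>x\<close> in \<open>V - {w}\<close>, but not to each other\<close>
    have "\<nu> V \<le> \<nu> (V - {w} - {y, v})"
      using z[OF y(1) yV(1,3)] z[OF v(1) vV(1) \<open>v \<noteq> x\<close>] fin xw xV yV vV \<open>v \<noteq> x\<close> x K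
      by (intro parallel_trans[of _ y x v]) (auto simp: delete_swap insert_commute)
    then show False using less by (simp add: delete_swap)
  qed
qed

text \<open>An essential neighbour of \<open>w\<close> survives by \<open>pos_ess_delete\<close>. If
  \<open>w\<close> became essential, then \<open>\<nu> (V - {w, x}) = \<nu> V\<close>, so
  \<open>x\<close> would be essential in \<open>V - {w}\<close> and, by
  \<open>ess_delete_spec\<close>, in \<open>V\<close>.\<close>

lemma spec_delete_pos:
  assumes fin: "finite V" and w: "spec \<theta> E V w" and x: "pos \<theta> E V x" and xw: "x \<noteq> w"
  shows "spec \<theta> E (V - {x}) w"
proof -
  obtain y where wV: "w \<in> V" "\<not> ess \<theta> E V w" and y: "{w, y} \<in> E" "ess \<theta> E V y"
    using w unfolding spec_def by blast
  have "\<not> ess \<theta> E (V - {x}) w"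
  proof
    assume "ess \<theta> E (V - {x}) w"
    then have "ess \<theta> E (V - {w}) x"
      using x xw spec_imp_pos[OF fin w] by (auto simp: ess_def pos_def delete_swap insert_commute)
    then have "ess \<theta> E V x" using ess_delete_spec[OF fin w xw] by simp
    then show False using x by (simp add: ess_def pos_def)
  qed
  then show ?thesis
    using pos_ess_delete(1)[OF fin x y(2)] y(1) wV xw unfolding spec_def by blast
qed

text \<open>Forwards, \<open>w\<close> is still special and hence positive in
  \<open>V - {x}\<close>, so the two deletions raise the multiplicity by two. Backwards, each
  deletion raises it by at most one.\<close>

lemma pos_delete_spec:
  assumes fin: "finite V" and w: "spec \<theta> E V w" and xw: "x \<noteq> w"
  shows "pos \<theta> E (V - {w}) x \<longleftrightarrow> pos \<theta> E V x"
proof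
  assume "pos \<theta> E V x"
  then have "pos \<theta> E (V - {x}) w" "pos \<theta> E V w"
    using spec_imp_pos spec_delete_pos[OF fin w] w fin xw by blast+
  then show "pos \<theta> E (V - {w}) x" using \<open>pos \<theta> E V x\<close> xw by (auto simp: pos_def delete_swap insert_commute)
next
  assume "pos \<theta> E (V - {w}) x"
  then show "pos \<theta> E V x"
    using delete_root_mult_le_Suc[of "V - {x}" w] delete_root_mult_le_Suc[of V x] fin spec_imp_pos[OF fin w]
    by (auto simp: pos_def delete_swap insert_commute)
qed

lemma spec_delete_spec:
  assumes fin: "finite V" and w: "spec \<theta> E V w" and xw: "x \<noteq> w"
  shows "spec \<theta> E (V - {w}) x \<longleftrightarrow> spec \<theta> E V x"
proof -
  have "ess \<theta> E (V - {w}) y \<longleftrightarrow> ess \<theta> E V y" for y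
    using ess_delete_spec[OF fin w, of y] w by (cases "y = w") (auto simp: spec_def ess_def)
  then show ?thesis using xw by (simp add: spec_def)
qed

section \<open>Deleting sets of vertices\<close>

lemma delete_set_root_mult_le:
  assumes "finite V" "finite B"
  shows "\<nu> (V - B) \<le> \<nu> V + card B"
  using assms(2)
proof (induction B rule: finite_induct)
  case (insert b B)
  have "\<nu> (V - B - {b}) \<le> Suc (\<nu> (V - B))"
  proof (cases "b \<in> V - B")
    case True
    then show ?thesis using assms(1) by (intro delete_root_mult_le_Suc) auto
  qed simp
  then show ?case using insert by (simp add: Diff_insert[of V b B])
qed simp

lemma delete_two_pos:
  assumes "finite V" "u \<in> V" "v \<in> V" "u \<noteq> v"
  shows "\<nu> (V - {u, v}) = \<nu> V + 2 \<longleftrightarrow> pos \<theta> E V u \<and> pos \<theta> E (V - {u}) v"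
  using assms delete_root_mult_le_Suc[of V u] delete_root_mult_le_Suc[of "V - {u}" v]
  by (auto simp: pos_def delete_swap)

text \<open>Members of \<open>B\<close> not yet deleted remain special, so stability applies to them
  one after another.\<close>

lemma delete_spec_set:
  assumes "finite V" "\<And>w. w \<in> B \<Longrightarrow> spec \<theta> E V w"
  shows "\<nu> (V - B) = \<nu> V + card B \<and>
    (\<forall>x. x \<notin> B \<longrightarrow> (ess \<theta> E (V - B) x \<longleftrightarrow> ess \<theta> E V x) \<and>
      (pos \<theta> E (V - B) x \<longleftrightarrow> pos \<theta> E V x) \<and> (spec \<theta> E (V - B) x \<longleftrightarrow> spec \<theta> E V x))"
proof -
  have "B \<subseteq> V" using assms(2) by (auto simp: spec_def)
  then have "finite B" using assms(1) finite_subset by blast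
  then show ?thesis using assms(2)
  proof (induction B rule: finite_induct)
    case (insert b B)
    then have IH: "\<nu> (V - B) = \<nu> V + card B"
      "\<And>x. x \<notin> B \<Longrightarrow> ess \<theta> E (V - B) x \<longleftrightarrow> ess \<theta> E V x"
      "\<And>x. x \<notin> B \<Longrightarrow> pos \<theta> E (V - B) x \<longleftrightarrow> pos \<theta> E V x"
      "\<And>x. x \<notin> B \<Longrightarrow> spec \<theta> E (V - B) x \<longleftrightarrow> spec \<theta> E V x"
      by auto
    have fin: "finite (V - B)" using assms(1) by simp
    have b: "spec \<theta> E (V - B) b" using IH(4) insert by simp
    have "\<nu> (V - B - {b}) = Suc (\<nu> (V - B))" using spec_imp_pos[OF fin b] by (simp add: pos_def)
    then have "\<nu> (V - insert b B) = \<nu> V + card (insert b B)"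
      using IH(1) insert.hyps by (simp add: Diff_insert[of V b B])
    moreover have "(ess \<theta> E (V - insert b B) x \<longleftrightarrow> ess \<theta> E V x) \<and>
      (pos \<theta> E (V - insert b B) x \<longleftrightarrow> pos \<theta> E V x) \<and> (spec \<theta> E (V - insert b B) x \<longleftrightarrow> spec \<theta> E V x)"
      if "x \<notin> insert b B" for x
    proof -
      have "x \<noteq> b" "x \<notin> B" using that by auto
      then show ?thesis
        unfolding Diff_insert[of V b B] ess_delete_spec[OF fin b \<open>x \<noteq> b\<close>]
          pos_delete_spec[OF fin b \<open>x \<noteq> b\<close>] spec_delete_spec[OF fin b \<open>x \<noteq> b\<close>]
        by (intro conjI IH(2-4))
    qed
    ultimately show ?case by blast
  qed simp
qed

text \<open>Forwards, \<open>B\<close> remains special in \<open>V - {u}\<close> because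
  \<open>u\<close> is positive, and deleting \<open>B\<close> there keeps \<open>v\<close> positive.
  Backwards, deleting \<open>B\<close> raises the multiplicity by exactly \<open>card B\<close> in
  \<open>V\<close> but by at most that in \<open>V - {u, v}\<close>.\<close>

lemma delete_two_pos_spec_set:
  assumes fin: "finite V" and B: "\<And>w. w \<in> B \<Longrightarrow> spec \<theta> E V w"
    and u: "u \<in> V - B" and v: "v \<in> V - B" and "u \<noteq> v"
  shows "\<nu> (V - {u, v}) = \<nu> V + 2 \<longleftrightarrow> \<nu> (V - B - {u, v}) = \<nu> (V - B) + 2"
proof -
  have "B \<subseteq> V" using B by (auto simp: spec_def)
  then have finB: "finite B" using fin finite_subset by blast
  have VB: "\<nu> (V - B) = \<nu> V + card B" using delete_spec_set[OF fin B] by blast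
  have swap: "V - B - {u, v} = V - {u, v} - B" "V - {u} - B - {v} = V - {u, v} - B" by auto
  show ?thesis
  proof
    assume "\<nu> (V - {u, v}) = \<nu> V + 2"
    then have pu: "pos \<theta> E V u" and pv: "pos \<theta> E (V - {u}) v"
      using delete_two_pos[of V u v] fin u v \<open>u \<noteq> v\<close> by auto
    have fin': "finite (V - {u})" using fin by simp
    have "spec \<theta> E (V - {u}) w" if "w \<in> B" for w
      using spec_delete_pos[OF fin B[OF that] pu] u that by blast
    from delete_spec_set[OF fin' this]
    have "\<nu> (V - {u} - B) = \<nu> (V - {u}) + card B" "pos \<theta> E (V - {u} - B) v"
      using pv v by auto
    then show "\<nu> (V - B - {u, v}) = \<nu> (V - B) + 2"
      using VB pu by (simp add: pos_def swap)
  next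
    assume *: "\<nu> (V - B - {u, v}) = \<nu> (V - B) + 2"
    have "\<nu> (V - {u, v} - B) \<le> \<nu> (V - {u, v}) + card B"
      using fin finB by (intro delete_set_root_mult_le) auto
    moreover have "\<nu> (V - {u, v}) \<le> \<nu> V + 2"
      using delete_set_root_mult_le[of V "{u, v}"] fin \<open>u \<noteq> v\<close> by simp
    ultimately show "\<nu> (V - {u, v}) = \<nu> V + 2" using * VB by (simp add: swap)
  qed
qed

text \<open>A special \<open>u\<close> always contributes one, and deleting it does not affect
  whether \<open>v\<close> is positive.\<close>

lemma delete_two_spec:
  assumes fin: "finite V" and u: "spec \<theta> E V u" and "v \<in> V" "u \<noteq> v"
  shows "\<nu> (V - {u, v}) = \<nu> V + 2 \<longleftrightarrow> pos \<theta> E V v"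
  using delete_two_pos[OF fin _ assms(3,4)] u spec_imp_pos[OF fin u] pos_delete_spec[OF fin u, of v] assms(4)
  by (auto simp: spec_def)

lemma root_mult_split:
  assumes "finite W" "\<And>x y. x \<in> W \<inter> C \<Longrightarrow> y \<in> W - C \<Longrightarrow> {x, y} \<notin> E"
  shows "\<nu> W = \<nu> (W \<inter> C) + \<nu> (W - C)"
  using root_mult_union[of "W \<inter> C" "W - C"] assms by (simp add: Int_Diff_Un Int_Diff_disjoint)

end

section \<open>Adding edges at special vertices\<close>

lemma root_mult_cong:
  "(\<And>e. e \<subseteq> V \<Longrightarrow> e \<in> E \<longleftrightarrow> e \<in> F) \<Longrightarrow> root_mult \<theta> E V = root_mult \<theta> F V"
  unfolding root_mult_def mpoly_def by (simp cong: matching_sum_cong)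

text \<open>Both edge sets agree on \<open>V - {w}\<close>, where the criterion finds the same
  essential neighbour of \<open>w\<close>. So \<open>w\<close> stays positive, which fixes the
  multiplicity of \<open>V\<close>; it also stays special, and stability for both edge sets carries
  the types over through \<open>V - {w}\<close>.\<close>

lemma add_edges_at_spec:
  assumes E: "loopless E" "loopless F" and sub: "E \<subseteq> F" and new: "\<And>e. e \<in> F \<Longrightarrow> w \<notin> e \<Longrightarrow> e \<in> E"
    and fin: "finite V" and w: "spec \<theta> E V w"
  shows "root_mult \<theta> F V = root_mult \<theta> E V \<and> (\<forall>x. (ess \<theta> F V x \<longleftrightarrow> ess \<theta> E V x) \<and>
    (pos \<theta> F V x \<longleftrightarrow> pos \<theta> E V x) \<and> (spec \<theta> F V x \<longleftrightarrow> spec \<theta> E V x))"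
proof -
  interpret G: matching_root E \<theta> using E(1) by unfold_locales
  interpret H: matching_root F \<theta> using E(2) by unfold_locales
  have cong: "root_mult \<theta> F U = root_mult \<theta> E U" if "w \<notin> U" for U
    by (rule root_mult_cong) (use sub new that in blast)
  have ess_cong: "ess \<theta> F U x \<longleftrightarrow> ess \<theta> E U x" and pos_cong: "pos \<theta> F U x \<longleftrightarrow> pos \<theta> E U x" if "w \<notin> U" for U x
    using that by (auto simp: ess_def pos_def cong)
  have w_V: "w \<in> V" and nE: "\<not> ess \<theta> E V w" using w by (auto simp: spec_def)
  obtain y where y: "{w, y} \<in> E" "ess \<theta> E V y" using w by (auto simp: spec_def)
  have pE: "pos \<theta> E V w" by (rule G.spec_imp_pos[OF fin w])
  have pos_w: "pos \<theta> F U w" if U: "pos \<theta> E U w" "finite U" for U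
  proof -
    obtain z where "{w, z} \<in> E" "ess \<theta> E (U - {w}) z"
      using G.pos_imp_nbr_ess_deleted[OF U(2,1)] by blast
    then show ?thesis
      using H.pos_if_nbr_ess_deleted[OF U(2), of w z] sub ess_cong[of "U - {w}" z] U(1)
      by (auto simp: pos_def)
  qed
  have eq: "root_mult \<theta> F U = root_mult \<theta> E U" if "pos \<theta> E U w" "finite U" for U
    using pos_w[OF that] that(1) cong[of "U - {w}"] by (simp add: pos_def)
  have pF: "pos \<theta> F V w" by (rule pos_w[OF pE fin])
  have ess_F: "ess \<theta> F V x" if x: "ess \<theta> E V x" for x
    using eq[OF pE fin] eq[OF G.pos_ess_delete(2)[OF fin pE x]] fin x by (simp add: ess_def)
  have specF: "spec \<theta> F V w"
    using pF y ess_F[OF y(2)] sub by (auto simp: spec_def pos_def ess_def)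
  have "w \<notin> V - {w}" by simp
  have ess: "ess \<theta> F V x \<longleftrightarrow> ess \<theta> E V x" for x
  proof (cases "x = w")
    case True
    then show ?thesis using specF w by (simp add: spec_def)
  next
    case False
    then show ?thesis
      using H.ess_delete_spec[OF fin specF] G.ess_delete_spec[OF fin w] ess_cong[OF \<open>w \<notin> V - {w}\<close>] by blast
  qed
  moreover have "pos \<theta> F V x \<longleftrightarrow> pos \<theta> E V x" for x
  proof (cases "x = w")
    case False
    then show ?thesis
      using H.pos_delete_spec[OF fin specF] G.pos_delete_spec[OF fin w] pos_cong[OF \<open>w \<notin> V - {w}\<close>] by blast
  qed (use pE pF in simp)
  moreover have "spec \<theta> F V x \<longleftrightarrow> spec \<theta> E V x" for x
  proof (cases "x = w")
    case False
    have "{x, z} \<in> F \<longleftrightarrow> {x, z} \<in> E" if "ess \<theta> E V z" for z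
    proof -
      have "w \<notin> {x, z}" using that nE False by auto
      then show ?thesis using sub new by blast
    qed
    then show ?thesis unfolding spec_def ess by blast
  qed (use w specF in simp)
  ultimately show ?thesis using eq[OF pE fin] by blast
qed

text \<open>For \<open>B\<close> the set of special vertices these are the pairs joined in
  \<open>S_graph\<close>; a general \<open>B\<close> allows the stars to be added one by
  one.\<close>

definition star_edges :: "'a set \<Rightarrow> 'a set \<Rightarrow> 'a set set" where
  "star_edges V B = {{w, z} | w z. w \<in> B \<and> z \<in> V \<and> z \<noteq> w}"

lemma loopless_star: "loopless E \<Longrightarrow> loopless (E \<union> star_edges V B)"
  unfolding loopless_def star_edges_def by blast

lemma add_star_edges:
  assumes E: "loopless E" and fin: "finite V" and B: "finite B" "\<And>w. w \<in> B \<Longrightarrow> spec \<theta> E V w"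
  defines "F \<equiv> \<lambda>B. E \<union> star_edges V B"
  shows "root_mult \<theta> (F B) V = root_mult \<theta> E V \<and> (\<forall>x. (ess \<theta> (F B) V x \<longleftrightarrow> ess \<theta> E V x) \<and>
    (pos \<theta> (F B) V x \<longleftrightarrow> pos \<theta> E V x) \<and> (spec \<theta> (F B) V x \<longleftrightarrow> spec \<theta> E V x))"
  using B
proof (induction B rule: finite_induct)
  case empty
  have "F {} = E" by (auto simp: F_def star_edges_def)
  then show ?case by simp
next
  case (insert b B)
  then have IH: "root_mult \<theta> (F B) V = root_mult \<theta> E V \<and> (\<forall>x. (ess \<theta> (F B) V x \<longleftrightarrow> ess \<theta> E V x) \<and>
    (pos \<theta> (F B) V x \<longleftrightarrow> pos \<theta> E V x) \<and> (spec \<theta> (F B) V x \<longleftrightarrow> spec \<theta> E V x))" by simp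
  have "loopless (F B)" "loopless (F (insert b B))" unfolding F_def by (intro loopless_star E)+
  moreover have "F B \<subseteq> F (insert b B)" unfolding F_def star_edges_def by blast
  moreover have "e \<in> F B" if "e \<in> F (insert b B)" "b \<notin> e" for e
    using that unfolding F_def star_edges_def by blast
  \<comment> \<open>The earlier stars changed no types, so \<open>b\<close> is still
    special.\<close>
  moreover have "spec \<theta> (F B) V b" using IH insert.prems by simp
  ultimately have "root_mult \<theta> (F (insert b B)) V = root_mult \<theta> (F B) V \<and>
    (\<forall>x. (ess \<theta> (F (insert b B)) V x \<longleftrightarrow> ess \<theta> (F B) V x) \<and>
      (pos \<theta> (F (insert b B)) V x \<longleftrightarrow> pos \<theta> (F B) V x) \<and> (spec \<theta> (F (insert b B)) V x \<longleftrightarrow> spec \<theta> (F B) V x))"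
    using fin by (intro add_edges_at_spec)
  then show ?case using IH by simp
qed

section \<open>Graphs and components\<close>

lemma card_Union_matching:
  assumes E: "loopless E" and fin: "finite V" and M: "M \<in> matchings E V"
  shows "card (\<Union>M) = 2 * card M"
proof -
  have "card e = 2" if "e \<in> M" for e
    using E M that by (force simp: loopless_def matchings_def)
  moreover have "finite e" if "e \<in> M" for e
    by (rule finite_subset[OF _ fin]) (use M that in \<open>auto simp: matchings_def\<close>)
  moreover have "pairwise disjnt M"
    using M by (simp add: matchings_def pairwise_def disjnt_def)
  ultimately show ?thesis by (simp add: card_Union_disjoint)
qed

text \<open>Matchings are grouped by size; one with \<open>r\<close> edges leaves exactly
  \<open>card V - 2 * r\<close> vertices uncovered.\<close>

lemma matching_poly_eq_mpoly:
  assumes E: "loopless E" and fin: "finite V"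
  shows "matching_poly (V, {e \<in> E. e \<subseteq> V}) = mpoly E V"
proof -
  let ?n = "card V" and ?X = "[:0, 1:] :: real poly"
  have num: "num_matchings (V, {e \<in> E. e \<subseteq> V}) r = card {M \<in> matchings E V. card M = r}" for r
    unfolding num_matchings_def is_matching_def matchings_def edges_def
    by (rule arg_cong[where f = card]) auto
  have le: "card M \<in> {0..?n div 2}" and unmatched: "card (V - \<Union>M) = ?n - 2 * card M"
    if M: "M \<in> matchings E V" for M
  proof -
    have sub: "\<Union>M \<subseteq> V" using M by (simp add: matchings_def)
    have "card (\<Union>M) \<le> ?n" using card_mono[OF fin sub] .
    then show "card M \<in> {0..?n div 2}" using card_Union_matching[OF E fin M] by simp
    show "card (V - \<Union>M) = ?n - 2 * card M"
      using card_Union_matching[OF E fin M] card_Diff_subset[OF finite_subset[OF sub fin] sub] by simp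
  qed
  have "mpoly E V = (\<Sum>M\<in>matchings E V. (-1) ^ card M * ?X ^ (?n - 2 * card M))"
    unfolding mpoly_def matching_sum_def by (intro sum.cong refl) (simp only: prod_constant unmatched)
  also have "\<dots> = (\<Sum>r\<in>{0..?n div 2}. \<Sum>M\<in>{M \<in> matchings E V. card M = r}. (-1) ^ card M * ?X ^ (?n - 2 * card M))"
    by (rule sum.group[symmetric]) (use le finite_matchings[OF fin] in auto)
  also have "\<dots> = (\<Sum>r\<in>{0..?n div 2}. monom ((-1) ^ r * real (num_matchings (V, {e \<in> E. e \<subseteq> V}) r)) (?n - 2 * r))"
  proof (rule sum.cong[OF refl])
    fix r
    have "(-1) ^ r = [:(-1) ^ r :: real:]" by (induction r) auto
    then have "monom ((-1) ^ r * real c) m = of_nat c * ((-1) ^ r * ?X ^ m)" for c m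
      by (simp add: monom_altdef of_nat_poly mult.commute)
    then show "(\<Sum>M\<in>{M \<in> matchings E V. card M = r}. (-1) ^ card M * ?X ^ (?n - 2 * card M))
      = monom ((-1) ^ r * real (num_matchings (V, {e \<in> E. e \<subseteq> V}) r)) (?n - 2 * r)"
      by (simp add: num)
  qed
  finally show ?thesis by (simp add: matching_poly_def verts_def)
qed

lemma mult_eq_root_mult: "loopless E \<Longrightarrow> finite V \<Longrightarrow> mult \<theta> (V, {e \<in> E. e \<subseteq> V}) = root_mult \<theta> E V"
  by (simp add: mult_def root_mult_def matching_poly_eq_mpoly)

lemma simple_graph_iff: "simple_graph (V, F) \<longleftrightarrow> finite V \<and> loopless F \<and> (\<forall>e\<in>F. e \<subseteq> V)"
  unfolding simple_graph_def loopless_def verts_def edges_def by fastforce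

lemma delete_induced_edges: "delete (V, {e \<in> E. e \<subseteq> V}) X = (V - X, {e \<in> E. e \<subseteq> V - X})"
  by (auto simp: delete_def verts_def edges_def)

lemma induced_induced_edges:
  "C \<subseteq> V \<Longrightarrow> induced (V, {e \<in> E. e \<subseteq> V}) C = (C, {e \<in> E. e \<subseteq> C})"
  by (auto simp: induced_def verts_def edges_def)

section \<open>Connected components\<close>

lemma component_refl: "x \<in> verts G \<Longrightarrow> \<exists>C\<in>components G. x \<in> C"
  unfolding components_def reachable_def by blast

lemma component_closed: "C \<in> components G \<Longrightarrow> x \<in> C \<Longrightarrow> {x, y} \<in> edges G \<Longrightarrow> y \<in> C"
  unfolding components_def reachable_def adj_def by (auto intro: rtrancl_into_rtrancl)

lemma component_reachable:
  assumes "C \<in> components G" "x \<in> C" "y \<in> C"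
  shows "(x, y) \<in> {(a, b). adj G a b}\<^sup>*"
proof -
  have "sym ({(a, b). adj G a b}\<^sup>*)"
    by (intro sym_rtrancl symI) (simp add: adj_def insert_commute)
  then show ?thesis
    using assms unfolding components_def reachable_def by (auto dest: symD intro: rtrancl_trans)
qed

lemma component_unique:
  assumes C: "C \<in> components G" and D: "D \<in> components G" and x: "x \<in> C" "x \<in> D"
  shows "C = D"
proof -
  have "D' \<subseteq> C'" if "C' \<in> components G" "D' \<in> components G" "x \<in> C'" "x \<in> D'" for C' D'
  proof
    fix y assume "y \<in> D'"
    with component_reachable[OF that(2,4)] have "(x, y) \<in> {(a, b). adj G a b}\<^sup>*" by blast
    then show "y \<in> C'"
    proof (induction rule: rtrancl_induct)
      case (step y z)
      then show ?case using component_closed[OF that(1) step.IH] by (simp add: adj_def)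
    qed (rule that(3))
  qed
  then show ?thesis using assms by blast
qed

lemma component_subset: "(\<And>e. e \<in> edges G \<Longrightarrow> e \<subseteq> verts G) \<Longrightarrow> C \<in> components G \<Longrightarrow> C \<subseteq> verts G"
proof
  fix x assume G: "\<And>e. e \<in> edges G \<Longrightarrow> e \<subseteq> verts G" and "C \<in> components G" "x \<in> C"
  then obtain z where z: "z \<in> verts G" and "(z, x) \<in> {(a, b). adj G a b}\<^sup>*"
    unfolding components_def reachable_def by blast
  from this(2) z show "x \<in> verts G"
    by (induction rule: rtrancl_induct) (use G in \<open>auto simp: adj_def\<close>)
qed

context matching_root
begin

lemma component_split:
  assumes fin: "finite V" and C: "C \<in> components (V, {e \<in> E. e \<subseteq> V})" and W: "W \<subseteq> V"
  shows "\<nu> W = \<nu> (W \<inter> C) + \<nu> (W - C)"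
proof (rule root_mult_split)
  show "{x, y} \<notin> E" if "x \<in> W \<inter> C" "y \<in> W - C" for x y
    using component_closed[OF C, of x y] that W by (auto simp: edges_def)
qed (use fin W finite_subset in blast)

text \<open>A component of positive multiplicity has an essential vertex, which is essential in
  \<open>V\<close> by additivity. Without special vertices, neighbours of essential vertices are
  essential, and this spreads along a path to \<open>u\<close>.\<close>

lemma component_root_mult_0:
  assumes fin: "finite V" and C: "C \<in> components (V, {e \<in> E. e \<subseteq> V})" and u: "u \<in> C"
    and nE: "\<not> ess \<theta> E V u" and nS: "\<And>x. \<not> spec \<theta> E V x"
  shows "\<nu> C = 0"
proof (rule ccontr)
  assume "\<nu> C \<noteq> 0"
  have CV: "C \<subseteq> V" using component_subset[OF _ C] by (auto simp: edges_def verts_def)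
  then have "finite C" using fin finite_subset by blast
  then obtain z where z: "ess \<theta> E C z" using ess_exists \<open>\<nu> C \<noteq> 0\<close> by blast
  have "\<nu> V = \<nu> C + \<nu> (V - C)" "\<nu> (V - {z}) = \<nu> (C - {z}) + \<nu> (V - C)"
  proof -
    have "(V - {z}) \<inter> C = C - {z}" "V - {z} - C = V - C" "V \<inter> C = C" using CV z by (auto simp: ess_def)
    then show "\<nu> V = \<nu> C + \<nu> (V - C)" "\<nu> (V - {z}) = \<nu> (C - {z}) + \<nu> (V - C)"
      using component_split[OF fin C, of V] component_split[OF fin C, of "V - {z}"] by auto
  qed
  then have zV: "ess \<theta> E V z" using z CV by (auto simp: ess_def)
  have "(z, u) \<in> {(a, b). adj (V, {e \<in> E. e \<subseteq> V}) a b}\<^sup>*"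
    using component_reachable[OF C _ u] z by (simp add: ess_def)
  then have "ess \<theta> E V u"
  proof (induction rule: rtrancl_induct)
    case (step a b)
    then show ?case using nS[of b] by (auto simp: spec_def adj_def edges_def insert_commute)
  qed (rule zV)
  then show False using nE by simp
qed

text \<open>If the multiplicity rises by two, both vertices are positive, so their components have
  multiplicity 0. By additivity distinct components contribute independently, and in a common one
  the whole increase takes place there.\<close>

lemma delete_two_components:
  assumes fin: "finite V" and nS: "\<And>x. \<not> spec \<theta> E V x"
    and u: "u \<in> V" and v: "v \<in> V" and "u \<noteq> v"
  defines "Qs \<equiv> {C \<in> components (V, {e \<in> E. e \<subseteq> V}). \<nu> C = 0}"
  shows "\<nu> (V - {u, v}) = \<nu> V + 2 \<longleftrightarrow>
     (pos \<theta> E V u \<and> pos \<theta> E V v \<and> (\<exists>C1\<in>Qs. \<exists>C2\<in>Qs. C1 \<noteq> C2 \<and> u \<in> C1 \<and> v \<in> C2))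
      \<or> (\<exists>C\<in>Qs. u \<in> C \<and> v \<in> C \<and> \<nu> (C - {u, v}) = 2)" (is "?L \<longleftrightarrow> ?R")
proof -
  let ?G = "(V, {e \<in> E. e \<subseteq> V})"
  have sub: "C \<subseteq> V" if "C \<in> components ?G" for C
    using component_subset[OF _ that] by (auto simp: edges_def verts_def)
  have split: "\<nu> (V - X) = \<nu> (C - X) + \<nu> (V - C)" if "C \<in> components ?G" "X \<subseteq> C" for C X
  proof -
    have "(V - X) \<inter> C = C - X" "V - X - C = V - C" using sub[OF that(1)] that(2) by auto
    then show ?thesis using component_split[OF fin that(1), of "V - X"] by auto
  qed
  show ?thesis
  proof
    assume L: ?L
    then have "pos \<theta> E V u" using delete_two_pos[OF fin u v \<open>u \<noteq> v\<close>] by simp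
    moreover have "pos \<theta> E V v"
      using L delete_two_pos[OF fin v u] \<open>u \<noteq> v\<close> by (simp add: insert_commute)
    ultimately have pos: "pos \<theta> E V x" if "x \<in> {u, v}" for x using that by blast
    have Q: "C \<in> Qs" if "C \<in> components ?G" "x \<in> C" "x \<in> {u, v}" for C x
      using component_root_mult_0[OF fin that(1,2) _ nS] pos[OF that(3)] that(1)
      by (simp add: Qs_def pos_def ess_def)
    obtain C1 where C1: "C1 \<in> components ?G" "u \<in> C1"
      using component_refl[of u ?G] u by (auto simp: verts_def)
    obtain C2 where C2: "C2 \<in> components ?G" "v \<in> C2"
      using component_refl[of v ?G] v by (auto simp: verts_def)
    note C = C1 C2
    then have CQ: "C1 \<in> Qs" "C2 \<in> Qs" using Q by blast+
    show ?R
    proof (cases "C1 = C2")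
      case True
      then have "\<nu> (C1 - {u, v}) = 2"
        using L split[OF C(1), of "{u, v}"] split[OF C(1), of "{}"] C CQ(1) by (simp add: Qs_def)
      then show ?thesis using True C CQ by blast
    next
      case False
      then show ?thesis using C CQ pos by blast
    qed
  next
    assume ?R
    then show ?L
    proof (elim disjE conjE bexE)
      fix C1 C2 assume pos: "pos \<theta> E V u" "pos \<theta> E V v"
        and C: "C1 \<in> Qs" "C2 \<in> Qs" "C1 \<noteq> C2" "u \<in> C1" "v \<in> C2"
      have C1: "C1 \<in> components ?G" using C(1) by (simp add: Qs_def)
      have "v \<notin> C1" using component_unique[OF C1 _ _ C(5)] C by (auto simp: Qs_def)
      then have "(V - {v}) \<inter> C1 = C1" "V - {v} - C1 = V - C1 - {v}"
        "(V - {u, v}) \<inter> C1 = C1 - {u}" "V - {u, v} - C1 = V - C1 - {v}"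
        using sub[OF C1] C(4) by auto
      then have "\<nu> (V - {v}) = \<nu> C1 + \<nu> (V - C1 - {v})" "\<nu> (V - {u, v}) = \<nu> (C1 - {u}) + \<nu> (V - C1 - {v})"
        using component_split[OF fin C1, of "V - {v}"] component_split[OF fin C1, of "V - {u, v}"] by auto
      then show ?L
        using split[OF C1, of "{u}"] split[OF C1, of "{}"] C(4) pos by (simp add: pos_def)
    next
      fix C assume "C \<in> Qs" "u \<in> C" "v \<in> C" "\<nu> (C - {u, v}) = 2"
      then show ?L using split[of C "{u, v}"] split[of C "{}"] by (simp add: Qs_def)
    qed
  qed
qed

end

section \<open>Back to graphs, and the theorem\<close>

lemma graph_vertex_types:
  assumes E: "loopless E" and fin: "finite V"
  defines "G \<equiv> (V, {e \<in> E. e \<subseteq> V})"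
  shows "essential \<theta> G u \<longleftrightarrow> ess \<theta> E V u" "positive \<theta> G u \<longleftrightarrow> pos \<theta> E V u" "special \<theta> G u \<longleftrightarrow> spec \<theta> E V u"
proof -
  show ess: "essential \<theta> G u \<longleftrightarrow> ess \<theta> E V u" for u
    using fin unfolding G_def essential_def ess_def delete_induced_edges
    by (auto simp: mult_eq_root_mult[OF E] verts_def)
  show "positive \<theta> G u \<longleftrightarrow> pos \<theta> E V u"
    using fin unfolding G_def positive_def pos_def delete_induced_edges
    by (auto simp: mult_eq_root_mult[OF E] verts_def)
  show "special \<theta> G u \<longleftrightarrow> spec \<theta> E V u"
    unfolding special_def spec_def ess adj_def by (auto simp: G_def verts_def edges_def ess_def)
qed

theorem theorem5p13:
  fixes G :: "'a graph" and \<theta> :: real and u v :: 'a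
  assumes "simple_graph G"
    and "u \<in> verts G" and "v \<in> verts G" and "u \<noteq> v"
  defines "H \<equiv> delete G (A_set \<theta> G)"
  defines "Qs \<equiv> {C \<in> components H. mult \<theta> (induced H C) = 0}"
  shows "mult \<theta> (delete (S_graph \<theta> G) {u, v}) = mult \<theta> (S_graph \<theta> G) + 2 \<longleftrightarrow>
     ((u \<in> A_set \<theta> G \<and> v \<in> A_set \<theta> G)
      \<or> (u \<in> A_set \<theta> G \<and> v \<in> P_set \<theta> G)
      \<or> (u \<in> P_set \<theta> G \<and> v \<in> A_set \<theta> G)
      \<or> (u \<in> P_set \<theta> G \<and> v \<in> P_set \<theta> G \<and>
          (\<exists>C1\<in>Qs. \<exists>C2\<in>Qs. C1 \<noteq> C2 \<and> u \<in> C1 \<and> v \<in> C2))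
      \<or> (\<exists>C\<in>Qs. u \<in> C \<and> v \<in> C \<and> mult \<theta> (delete (induced H C) {u, v}) = 2))"
proof -
  obtain V E where G: "G = (V, E)" by (cases G)
  have fin: "finite V" and E: "loopless E" and EV: "\<And>e. e \<in> E \<Longrightarrow> e \<subseteq> V"
    using assms(1) unfolding G simple_graph_iff by blast+
  have uv: "u \<in> V" "v \<in> V" using assms(2,3) by (simp_all add: G verts_def)
  have GE: "G = (V, {e \<in> E. e \<subseteq> V})" using EV by (auto simp: G)
  define A where "A = A_set \<theta> G"
  have A: "x \<in> A \<longleftrightarrow> spec \<theta> E V x" for x
    using graph_vertex_types(3)[OF E fin] by (auto simp: A_def A_set_def GE spec_def verts_def)
  have P: "x \<in> P_set \<theta> G \<longleftrightarrow> x \<notin> A \<and> pos \<theta> E V x" for x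
    using graph_vertex_types(2,3)[OF E fin] by (auto simp: A P_set_def GE pos_def verts_def)
  have AV: "A \<subseteq> V" by (auto simp: A spec_def)
  have finA: "finite A" using AV fin finite_subset by blast
  define F where "F = E \<union> star_edges V A"
  have F: "loopless F" unfolding F_def by (rule loopless_star[OF E])
  have S: "S_graph \<theta> G = (V, {e \<in> F. e \<subseteq> V})"
    using EV AV by (auto simp: S_graph_def F_def star_edges_def A_def[symmetric]) (auto simp: G verts_def edges_def)
  interpret M: matching_root E \<theta> using E by unfold_locales
  interpret MS: matching_root F \<theta> using F by unfold_locales
  have "root_mult \<theta> F V = root_mult \<theta> E V \<and> (\<forall>x. (ess \<theta> F V x \<longleftrightarrow> ess \<theta> E V x) \<and>
    (pos \<theta> F V x \<longleftrightarrow> pos \<theta> E V x) \<and> (spec \<theta> F V x \<longleftrightarrow> spec \<theta> E V x))"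
    unfolding F_def by (rule add_star_edges[OF E fin finA]) (simp add: A)
  then have specF: "spec \<theta> F V x \<longleftrightarrow> x \<in> A" and posF: "pos \<theta> F V x \<longleftrightarrow> pos \<theta> E V x" for x
    by (simp_all add: A)
  define W where "W = V - A"
  have finW: "finite W" using fin by (simp add: W_def)
  \<comment> \<open>Every added edge meets \<open>A\<close>, so none lies inside
    \<open>W\<close>.\<close>
  have FW: "root_mult \<theta> F U = root_mult \<theta> E U" if "U \<subseteq> W" for U
    by (rule root_mult_cong) (use that in \<open>auto simp: F_def star_edges_def W_def\<close>)
  \<comment> \<open>Outside \<open>A\<close> no vertex is special in \<open>V\<close>, and deleting
    \<open>A\<close> makes none special.\<close>
  have nS: "\<not> spec \<theta> E W x" for x
    using M.delete_spec_set[OF fin, of A] A by (cases "x \<in> A") (auto simp: W_def spec_def)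
  have posW: "pos \<theta> E W x \<longleftrightarrow> pos \<theta> E V x" if "x \<notin> A" for x
    using M.delete_spec_set[OF fin, of A] A that by (auto simp: W_def)
  have H: "H = (W, {e \<in> E. e \<subseteq> W})"
  proof -
    have "H = delete (V, {e \<in> E. e \<subseteq> V}) A" by (simp only: H_def A_def GE[symmetric])
    then show ?thesis by (simp only: delete_induced_edges W_def)
  qed
  have sub: "C \<subseteq> W" if "C \<in> components H" for C
    using component_subset[OF _ that] by (auto simp: H edges_def verts_def)
  have multC: "mult \<theta> (induced H C) = root_mult \<theta> E C"
    "mult \<theta> (delete (induced H C) {u, v}) = root_mult \<theta> E (C - {u, v})" if "C \<in> components H" for C
  proof -
    have "finite C" using sub[OF that] finW finite_subset by blast
    then show "mult \<theta> (induced H C) = root_mult \<theta> E C"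
      "mult \<theta> (delete (induced H C) {u, v}) = root_mult \<theta> E (C - {u, v})"
      unfolding H induced_induced_edges[OF sub[OF that]] delete_induced_edges
      by (simp_all add: mult_eq_root_mult[OF E])
  qed
  have Qs: "Qs = {C \<in> components (W, {e \<in> E. e \<subseteq> W}). root_mult \<theta> E C = 0}"
    unfolding Qs_def using multC by (auto simp: H)
  have QW: "C \<subseteq> W" "mult \<theta> (delete (induced H C) {u, v}) = root_mult \<theta> E (C - {u, v})" if "C \<in> Qs" for C
    using that sub multC(2) by (auto simp: Qs_def)
  have lhs: "mult \<theta> (delete (S_graph \<theta> G) {u, v}) = mult \<theta> (S_graph \<theta> G) + 2 \<longleftrightarrow>
      root_mult \<theta> F (V - {u, v}) = root_mult \<theta> F V + 2"
    unfolding S delete_induced_edges using fin by (simp add: mult_eq_root_mult[OF F])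
  have posA: "pos \<theta> E V x" if "x \<in> A" for x using M.spec_imp_pos[OF fin] that A by blast
  \<comment> \<open>If one vertex is special, what counts is whether the other is positive, that is,
    in \<open>A\<close> or in \<open>P_set \<theta> G\<close>; the last two alternatives cannot
    occur, as components of \<open>H\<close> avoid \<open>A\<close>.\<close>
  consider "u \<in> A" | "v \<in> A" "u \<notin> A" | "u \<in> W" "v \<in> W" using uv by (auto simp: W_def)
  then show ?thesis
  proof cases
    case 1
    then have "root_mult \<theta> F (V - {u, v}) = root_mult \<theta> F V + 2 \<longleftrightarrow> pos \<theta> E V v"
      using MS.delete_two_spec[OF fin _ uv(2) assms(4)] specF posF by simp
    moreover have "u \<notin> C" if "C \<in> Qs" for C using QW(1)[OF that] 1 by (auto simp: W_def)
    ultimately show ?thesis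
      unfolding lhs A_def[symmetric] P using 1 posA by blast
  next
    case 2
    then have "root_mult \<theta> F (V - {u, v}) = root_mult \<theta> F V + 2 \<longleftrightarrow> pos \<theta> E V u"
      using MS.delete_two_spec[OF fin _ uv(1) assms(4)[symmetric]] specF posF by (simp add: insert_commute)
    moreover have "v \<notin> C" if "C \<in> Qs" for C using QW(1)[OF that] 2 by (auto simp: W_def)
    ultimately show ?thesis
      unfolding lhs A_def[symmetric] P using 2 by blast
  next
    case 3
    then have nA: "u \<notin> A" "v \<notin> A" by (auto simp: W_def)
    \<comment> \<open>\<open>A\<close> is also the set of special vertices for \<open>F\<close>, so
      the question reduces to \<open>W\<close>, where \<open>F\<close> may be replaced by
      \<open>E\<close>.\<close>
    have "root_mult \<theta> F (V - {u, v}) = root_mult \<theta> F V + 2 \<longleftrightarrow>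
        root_mult \<theta> F (W - {u, v}) = root_mult \<theta> F W + 2"
      unfolding W_def by (rule MS.delete_two_pos_spec_set[OF fin]) (use specF uv nA assms(4) in auto)
    also have "\<dots> \<longleftrightarrow> root_mult \<theta> E (W - {u, v}) = root_mult \<theta> E W + 2"
      by (simp add: FW)
    also note M.delete_two_components[OF finW nS 3 assms(4), folded Qs]
    finally show ?thesis
      unfolding lhs A_def[symmetric] P using nA by (simp add: posW QW(2) cong: bex_cong)
  qed
qed

end
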